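(* Let $(\phi_t)$ be a parabolic semigroup of positive hyperbolic step in $\mathbb{D}$ whose Koenigs domain $\Omega$ is contained in the upper half-plane $S(0,\pi)$, and let $(T_t)$ be the induced semigroup of composition operators. Let $p\ge1$, $\alpha>-1$, and let $\sigma_{p,\alpha}$ be the point spectrum of the infinitesimal generator of $(T_t)$ acting on the Bergman space $A^p_\alpha$. Let $\theta_\Omega$, $\Theta_\Omega$ be the inner and outer arguments of $(\phi_t)$. Then: (a) If $\theta_\Omega=\Theta_\Omega=0$, then $iS[0,\pi)\cup\{0\}\subseteq\sigma_{p,\alpha}\subseteq i\overline{S(0,\pi)}$. (b) If $\theta_\Omega=\Theta_\Omega\in(0,\pi)$, then $iS[0,\pi-\theta_\Omega)\cup\{0\}\subseteq\sigma_{p,\alpha}\subseteq i\overline{S(0,\pi-\theta_\Omega)}$. (c) If $\theta_\Omega=\Theta_\Omega=\pi$, then $\sigma_{p,\alpha}=\{it:t\ge0\}$. (d) If $\theta_\Omega<\Theta_\Omega$, then $iS[0,\pi-\Theta_\Omega)\cup\{0\}\subseteq\sigma_{p,\alpha}\subseteq i\overline{S(0,\pi-\theta_\Omega)}$, where in case $\Theta_\Omega=\pi$ the set on the left is replaced by the half-line $\{it:t\ge0\}$, and in case $\theta_\Omega=0$ the set on the right is $i\overline{S(0,\pi)}$. Moreover, all the same results hold with $\sigma_{p,\alpha}$ replaced by the point spectrum $\sigma_p$ of the infinitesimal generator of $(T_t)$ acting on the Hardy space $H^p$, $p\ge1$.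
   Context: $\mathbb{D}$ is the open unit disk. A semigroup in $\mathbb{D}$ is a family $(\phi_t)_{t\ge0}$ of holomorphic maps $\phi_t:\mathbb{D}\to\mathbb{D}$ with $\phi_0=\mathrm{id}$, $\phi_{t+s}=\phi_t\circ\phi_s$ for all $t,s\ge0$, and $\phi_t(z)\to z$ uniformly on compacta as $t\to0^+$. It is non-elliptic if there is $\tau\in\partial\mathbb{D}$ (the Denjoy–Wolff point) with $\phi_t(z)\to\tau$ as $t\to+\infty$ for all $z\in\mathbb{D}$; a non-elliptic semigroup is parabolic if the angular derivative satisfies $\phi_1'(\tau)=1$. For a non-elliptic semigroup there is a univalent map $h:\mathbb{D}\to\mathbb{C}$, unique up to translation, the Koenigs function, with $h(\phi_t(z))=h(z)+t$ for all $t\ge0$, $z\in\mathbb{D}$; $\Omega:=h(\mathbb{D})$ is the Koenigs domain. A parabolic semigroup is of positive hyperbolic step if $\Omega$ is contained in a horizontal half-plane, i.e. a half-plane $\{\mathrm{Im}\,w>c\}$ or $\{\mathrm{Im}\,w<c\}$. For $a<b$ in $[-\pi,\pi]$: $S(a,b)=\{w\in\mathbb{C}:a<\arg w<b\}$, $S[a,b)=\{w\in\mathbb{C}:a\le\arg w<b\}$, and $\overline{S(a,b)}$ is the topological closure in $\mathbb{C}$; $iE=\{iw:w\in E\}$. Inner argument: $\theta_\Omega=\sup\left(\{0\}\cup\{\theta\in(0,\pi]:\exists\,q_\theta\in\mathbb{C}\text{ with }q_\theta+S(0,\theta)\subseteq\Omega\}\right)$. Outer argument: $\Theta_\Omega=\inf\{\theta\in(0,\pi]:\exists\,q_\theta\in\mathbb{C}\text{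 with }\Omega\subseteq q_\theta+S(0,\theta)\}$. $A^p_\alpha$ is the Banach space of holomorphic $f$ on $\mathbb{D}$ with $\|f\|^p_{A^p_\alpha}=\int_{\mathbb{D}}|f(z)|^p(1-|z|^2)^\alpha\,dA(z)<+\infty$ ($dA$ normalized area measure); $H^p$ is the Banach space of holomorphic $f$ on $\mathbb{D}$ with $\|f\|_{H^p}^p=\sup_{0\le r<1}\int_0^{2\pi}|f(re^{i\theta})|^p\,d\theta<+\infty$. On $X=A^p_\alpha$ or $H^p$, $T_t(f)=f\circ\phi_t$ is a strongly continuous semigroup of bounded operators; its infinitesimal generator is $\Gamma_X(f)=\lim_{t\to0^+}(T_t(f)-f)/t$ (norm limit), defined on those $f\in X$ for which the limit exists in $X$. The point spectrum is the set of eigenvalues $\lambda\in\mathbb{C}$ of $\Gamma_X$. *)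

theory Defs
  imports "HOL-Complex_Analysis.Complex_Analysis"
begin

section \<open>Semigroups of holomorphic self-maps of the unit disk\<close>

abbreviation unit_disk :: "complex set" (\<open>\<bbbD>\<close>)
  where "\<bbbD> \<equiv> ball 0 1"

text \<open>The maps are total functions, but only parameters \<open>t \<ge> 0\<close> and values on the disk
  are constrained.\<close>

definition holo_semigroup :: "(real \<Rightarrow> complex \<Rightarrow> complex) \<Rightarrow> bool" where
  "holo_semigroup \<phi> \<longleftrightarrow>
     (\<forall>t\<ge>0. \<phi> t holomorphic_on \<bbbD> \<and> \<phi> t ` \<bbbD> \<subseteq> \<bbbD>) \<and>
     (\<forall>z\<in>\<bbbD>. \<phi> 0 z = z) \<and>
     (\<forall>t\<ge>0. \<forall>s\<ge>0. \<forall>z\<in>\<bbbD>. \<phi> (t + s) z = \<phi> t (\<phi> s z)) \<and>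
     (\<forall>K. compact K \<and> K \<subseteq> \<bbbD> \<longrightarrow> uniform_limit K \<phi> (\<lambda>z. z) (at_right 0))"

definition denjoy_wolff_point :: "(real \<Rightarrow> complex \<Rightarrow> complex) \<Rightarrow> complex \<Rightarrow> bool" where
  "denjoy_wolff_point \<phi> \<tau> \<longleftrightarrow>
     \<tau> \<in> sphere 0 1 \<and> (\<forall>z\<in>\<bbbD>. ((\<lambda>t. \<phi> t z) \<longlongrightarrow> \<tau>) at_top)"

definition non_elliptic :: "(real \<Rightarrow> complex \<Rightarrow> complex) \<Rightarrow> bool" where
  "non_elliptic \<phi> \<longleftrightarrow> holo_semigroup \<phi> \<and> (\<exists>\<tau>. denjoy_wolff_point \<phi> \<tau>)"

definition stolz_region :: "complex \<Rightarrow> real \<Rightarrow> complex set" where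
  "stolz_region \<tau> R = {z \<in> \<bbbD>. cmod (z - \<tau>) < R * (1 - cmod z)}"

definition has_angular_limit :: "(complex \<Rightarrow> complex) \<Rightarrow> complex \<Rightarrow> complex \<Rightarrow> bool" where
  "has_angular_limit f l \<tau> \<longleftrightarrow> (\<forall>R>1. (f \<longlongrightarrow> l) (at \<tau> within stolz_region \<tau> R))"

text \<open>The boundary value \<open>\<eta>\<close> is determined by finiteness of the limit; at the Denjoy--Wolff
  point it is the point itself.\<close>

definition has_angular_derivative :: "(complex \<Rightarrow> complex) \<Rightarrow> complex \<Rightarrow> complex \<Rightarrow> bool" where
  "has_angular_derivative f d \<tau> \<longleftrightarrow>
     (\<exists>\<eta>\<in>sphere 0 1. has_angular_limit f \<eta> \<tau> \<and>
        has_angular_limit (\<lambda>z. (f z - \<eta>) / (z - \<tau>)) d \<tau>)"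

definition parabolic :: "(real \<Rightarrow> complex \<Rightarrow> complex) \<Rightarrow> bool" where
  "parabolic \<phi> \<longleftrightarrow> non_elliptic \<phi> \<and>
     (\<exists>\<tau>. denjoy_wolff_point \<phi> \<tau> \<and> has_angular_derivative (\<phi> 1) 1 \<tau>)"

text \<open>A Koenigs function is determined up to an additive constant: if \<open>h\<close> and \<open>k\<close> both
  linearise the semigroup, then \<open>k \<circ> h\<^sup>-\<^sup>1\<close> has derivative 1.\<close>

definition koenigs_function ::
    "(real \<Rightarrow> complex \<Rightarrow> complex) \<Rightarrow> (complex \<Rightarrow> complex) \<Rightarrow> bool" where
  "koenigs_function \<phi> h \<longleftrightarrow>
     h holomorphic_on \<bbbD> \<and> inj_on h \<bbbD> \<and>
     (\<forall>t\<ge>0. \<forall>z\<in>\<bbbD>. h (\<phi> t z) = h z + of_real t)"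

definition positive_hyperbolic_step :: "(real \<Rightarrow> complex \<Rightarrow> complex) \<Rightarrow> bool" where
  "positive_hyperbolic_step \<phi> \<longleftrightarrow>
     (\<exists>h c. koenigs_function \<phi> h \<and>
        (h ` \<bbbD> \<subseteq> {w. Im w > c} \<or> h ` \<bbbD> \<subseteq> {w. Im w < c}))"


section \<open>Sectors and the inner and outer arguments\<close>

text \<open>The argument of 0 is undefined on paper but \<open>Arg 0 = 0\<close> in the library, so the
  vertex is excluded explicitly.\<close>

definition sector :: "real \<Rightarrow> real \<Rightarrow> complex set" where
  "sector a b = {w. w \<noteq> 0 \<and> a < Arg w \<and> Arg w < b}"

definition sector_lclosed :: "real \<Rightarrow> real \<Rightarrow> complex set" where
  "sector_lclosed a b = {w. w \<noteq> 0 \<and> a \<le> Arg w \<and> Arg w < b}"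

definition inner_argument :: "complex set \<Rightarrow> real" where
  "inner_argument \<Omega> =
     Sup ({0} \<union> {\<theta>. 0 < \<theta> \<and> \<theta> \<le> pi \<and> (\<exists>q. (+) q ` sector 0 \<theta> \<subseteq> \<Omega>)})"

text \<open>The infimum is over a nonempty set as soon as \<open>\<Omega>\<close> lies in a half-plane
  \<open>{w. Im w > c}\<close>.\<close>

definition outer_argument :: "complex set \<Rightarrow> real" where
  "outer_argument \<Omega> =
     Inf {\<theta>. 0 < \<theta> \<and> \<theta> \<le> pi \<and> (\<exists>q. \<Omega> \<subseteq> (+) q ` sector 0 \<theta>)}"


section \<open>Bergman and Hardy spaces\<close>

text \<open>Elements are represented by total functions of which only the restriction to the disk
  matters; two representatives are identified when they agree there.\<close>

definition bergman_space :: "real \<Rightarrow> real \<Rightarrow> (complex \<Rightarrow> complex) set" where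
  "bergman_space p \<alpha> = {f. f holomorphic_on \<bbbD> \<and>
     set_integrable lborel \<bbbD> (\<lambda>z. cmod (f z) powr p * (1 - (cmod z)\<^sup>2) powr \<alpha>)}"

text \<open>The factor \<open>1 / pi\<close> normalizes the area measure of the disk.\<close>

definition bergman_norm :: "real \<Rightarrow> real \<Rightarrow> (complex \<Rightarrow> complex) \<Rightarrow> real" where
  "bergman_norm p \<alpha> f =
     (1 / pi * (LINT z:\<bbbD>|lborel. cmod (f z) powr p * (1 - (cmod z)\<^sup>2) powr \<alpha>)) powr (1 / p)"

definition circle_integral :: "real \<Rightarrow> (complex \<Rightarrow> complex) \<Rightarrow> real \<Rightarrow> real" where
  "circle_integral p f r =
     (LINT \<theta>:{0..2 * pi}|lborel. cmod (f (of_real r * cis \<theta>)) powr p)"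

definition hardy_space :: "real \<Rightarrow> (complex \<Rightarrow> complex) set" where
  "hardy_space p = {f. f holomorphic_on \<bbbD> \<and> bdd_above (circle_integral p f ` {0..<1})}"

definition hardy_norm :: "real \<Rightarrow> (complex \<Rightarrow> complex) \<Rightarrow> real" where
  "hardy_norm p f = (SUP r\<in>{0..<1}. circle_integral p f r) powr (1 / p)"


section \<open>Generator of the composition semigroup and its point spectrum\<close>

definition composition_op ::
    "(real \<Rightarrow> complex \<Rightarrow> complex) \<Rightarrow> real \<Rightarrow> (complex \<Rightarrow> complex) \<Rightarrow> complex \<Rightarrow> complex" where
  "composition_op \<phi> t f = (\<lambda>z. f (\<phi> t z))"

text \<open>The graph of the infinitesimal generator on the space \<open>X\<close> with norm \<open>N\<close>: \<open>f\<close> is in the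
  domain and is mapped to \<open>g\<close>. The norms are real-valued and meaningful only on \<open>X\<close>,
  so membership of the difference is part of norm convergence.\<close>

definition generator_maps ::
    "(complex \<Rightarrow> complex) set \<Rightarrow> ((complex \<Rightarrow> complex) \<Rightarrow> real) \<Rightarrow>
     (real \<Rightarrow> (complex \<Rightarrow> complex) \<Rightarrow> complex \<Rightarrow> complex) \<Rightarrow>
     (complex \<Rightarrow> complex) \<Rightarrow> (complex \<Rightarrow> complex) \<Rightarrow> bool" where
  "generator_maps X N T f g \<longleftrightarrow> f \<in> X \<and> g \<in> X \<and>
     (\<forall>\<^sub>F t in at_right 0. (\<lambda>z. (T t f z - f z) / of_real t - g z) \<in> X) \<and>
     ((\<lambda>t. N (\<lambda>z. (T t f z - f z) / of_real t - g z)) \<longlongrightarrow> 0) (at_right 0)"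

definition generator_point_spectrum ::
    "(complex \<Rightarrow> complex) set \<Rightarrow> ((complex \<Rightarrow> complex) \<Rightarrow> real) \<Rightarrow>
     (real \<Rightarrow> (complex \<Rightarrow> complex) \<Rightarrow> complex \<Rightarrow> complex) \<Rightarrow> complex set" where
  "generator_point_spectrum X N T =
     {l. \<exists>f. (\<exists>z\<in>\<bbbD>. f z \<noteq> 0) \<and> generator_maps X N T f (\<lambda>z. l * f z)}"

definition bergman_point_spectrum ::
    "real \<Rightarrow> real \<Rightarrow> (real \<Rightarrow> complex \<Rightarrow> complex) \<Rightarrow> complex set" where
  "bergman_point_spectrum p \<alpha> \<phi> =
     generator_point_spectrum (bergman_space p \<alpha>) (bergman_norm p \<alpha>) (composition_op \<phi>)"

definition hardy_point_spectrum ::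
    "real \<Rightarrow> (real \<Rightarrow> complex \<Rightarrow> complex) \<Rightarrow> complex set" where
  "hardy_point_spectrum p \<phi> =
     generator_point_spectrum (hardy_space p) (hardy_norm p) (composition_op \<phi>)"

end

theory Submission imports Defs begin

text \<open>
  In the coordinate \<open>w = h z\<close> the semigroup acts by translation, so an eigenfunction of the generator with
  eigenvalue \<open>l\<close> is a multiple of \<open>exp (l * h)\<close>. Hence the point spectrum on a space \<open>X\<close> is the set of
  all \<open>l\<close> with \<open>exp (l * h) \<in> X\<close> (\<open>point_spectrum_iff_exp_koenigs\<close>). Two properties
  of \<open>X\<close> then decide the matter: it contains the bounded holomorphic functions, and its elements grow at most
  like a power of \<open>1 / (1 - cmod z)\<close>, with a constant proportional to the norm. The locale
  \<open>disk_function_space\<close> abstracts from the Bergman and Hardy spaces, for which the growth bound follows from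
  mean value inequalities.

  Write \<open>l = \<i> * \<mu>\<close>. If \<open>h ` \<bbbD>\<close> lies in a translate of \<open>sector 0 b\<close> and \<open>0 \<le> Arg \<mu> \<le> \<pi> - b\<close>, then
  \<open>exp (\<i> * \<mu> * h)\<close> is bounded, so \<open>l\<close> is an eigenvalue. This gives all the lower inclusions.

  The upper inclusions compare the exact growth of \<open>exp (\<i> * \<mu> * h)\<close> along a sequence with the growth allowed in
  \<open>X\<close>. The latter is controlled by the Schwarz--Pick lemma: if consecutive points of a sequence have
  pseudohyperbolic distance at most \<open>e < 1/3\<close>, the distance to the boundary decreases at most by the factor
  \<open>1 - 3 * e\<close> per step (\<open>pseudohyperbolic_chain\<close>), so elements of \<open>X\<close> grow at most geometrically along it.

  Two sequences are used. As the semigroup is parabolic, \<open>\<phi> 1\<close> moves some point of the radius ending at the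
  Denjoy--Wolff point by an arbitrarily small pseudohyperbolic distance \<open>e\<close>. The orbit of such a point has steps bounded by
  \<open>e\<close>, while the eigenfunction is multiplied by a factor of modulus \<open>exp (Re l)\<close> at each step; as \<open>e\<close> is
  arbitrary, \<open>Re l \<le> 0\<close>, that is, \<open>0 \<le> Im \<mu>\<close> (\<open>Re_eigenvalue_nonpos\<close>). Secondly, if \<open>h ` \<bbbD>\<close> contains a translate of
  \<open>sector 0 \<theta>\<close>, then points in geometric progression on a ray of that sector have preimages with bounded steps. If
  \<open>Arg \<mu> + \<theta> > \<pi>\<close>, the ray can be chosen such that \<open>exp (\<i> * \<mu> * w)\<close> grows exponentially along it, hence doubly
  exponentially in the number of steps, a contradiction (\<open>Arg_eigenvalue_le\<close>).
\<close>

section \<open>Rotation invariance of plane Lebesgue measure\<close>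

lemma measurable_Complex [measurable]:
  assumes [measurable]: "f \<in> borel_measurable M" "g \<in> borel_measurable M"
  shows "(\<lambda>z. Complex (f z) (g z)) \<in> borel_measurable M"
  unfolding Complex_eq by measurable

lemma lborel_complex_eq_distr:
  "(lborel :: complex measure) = distr (lborel \<Otimes>\<^sub>M lborel) borel (\<lambda>(x, y). Complex x y)"
proof (rule lborel_eqI)
  fix l u :: complex
  assume le: "\<And>b. b \<in> Basis \<Longrightarrow> l \<bullet> b \<le> u \<bullet> b"
  have [measurable]: "(\<lambda>(x, y). Complex x y) \<in> borel_measurable (lborel \<Otimes>\<^sub>M lborel)"
    by measurable
  have box: "(\<lambda>(x, y). Complex x y) -` box l u = {Re l<..<Re u} \<times> {Im l<..<Im u}"
    by (auto simp: box_def Basis_complex_def inner_complex_def)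
  have "Re l \<le> Re u" "Im l \<le> Im u"
    using le [of 1] le [of \<i>] by (auto simp: Basis_complex_def inner_complex_def)
  moreover have "(1 :: complex) \<noteq> \<i>"
    by (metis complex_i_not_one)
  ultimately show "emeasure (distr (lborel \<Otimes>\<^sub>M lborel) borel (\<lambda>(x, y). Complex x y)) (box l u)
      = (\<Prod>b\<in>Basis. (u - l) \<bullet> b)"
    by (simp add: emeasure_distr box space_pair_measure lborel.emeasure_pair_measure_Times
        Basis_complex_def inner_complex_def ennreal_mult)
qed simp

lemma nn_integral_lborel_complex:
  fixes u :: "complex \<Rightarrow> ennreal"
  assumes [measurable]: "u \<in> borel_measurable borel"
  shows "(\<integral>\<^sup>+z. u z \<partial>lborel) = (\<integral>\<^sup>+x. \<integral>\<^sup>+y. u (Complex x y) \<partial>lborel \<partial>lborel)"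
    and "(\<integral>\<^sup>+z. u z \<partial>lborel) = (\<integral>\<^sup>+y. \<integral>\<^sup>+x. u (Complex x y) \<partial>lborel \<partial>lborel)"
proof -
  have [measurable]: "(\<lambda>(x, y). Complex x y) \<in> borel_measurable (lborel \<Otimes>\<^sub>M lborel)"
    by measurable
  have eq: "(\<integral>\<^sup>+z. u z \<partial>lborel) = (\<integral>\<^sup>+w. u (case w of (x, y) \<Rightarrow> Complex x y) \<partial>(lborel \<Otimes>\<^sub>M lborel))"
    by (subst lborel_complex_eq_distr) (simp add: nn_integral_distr)
  show "(\<integral>\<^sup>+z. u z \<partial>lborel) = (\<integral>\<^sup>+x. \<integral>\<^sup>+y. u (Complex x y) \<partial>lborel \<partial>lborel)"
    unfolding eq by (subst lborel.nn_integral_fst [symmetric]) simp_all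
  show "(\<integral>\<^sup>+z. u z \<partial>lborel) = (\<integral>\<^sup>+y. \<integral>\<^sup>+x. u (Complex x y) \<partial>lborel \<partial>lborel)"
    unfolding eq by (subst lborel_pair.nn_integral_snd [symmetric]) simp_all
qed

lemma nn_integral_lborel_translate:
  fixes u :: "'a::euclidean_space \<Rightarrow> ennreal"
  assumes [measurable]: "u \<in> borel_measurable borel"
  shows "(\<integral>\<^sup>+x. u (c + x) \<partial>lborel) = (\<integral>\<^sup>+x. u x \<partial>lborel)"
proof -
  have "(\<integral>\<^sup>+x. u x \<partial>lborel) = (\<integral>\<^sup>+x. u x \<partial>distr lborel borel ((+) c))"
    by (simp add: lborel_distr_plus)
  also have "\<dots> = (\<integral>\<^sup>+x. u (c + x) \<partial>lborel)"
    by (rule nn_integral_distr) auto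
  finally show ?thesis by simp
qed

lemma nn_integral_shear_x:
  fixes u :: "complex \<Rightarrow> ennreal"
  assumes [measurable]: "u \<in> borel_measurable borel"
  shows "(\<integral>\<^sup>+z. u (Complex (a * Im z + Re z) (Im z)) \<partial>lborel) = (\<integral>\<^sup>+z. u z \<partial>lborel)"
proof -
  have "(\<integral>\<^sup>+z. u (Complex (a * Im z + Re z) (Im z)) \<partial>lborel)
      = (\<integral>\<^sup>+y. \<integral>\<^sup>+x. u (Complex (a * y + x) y) \<partial>lborel \<partial>lborel)"
    by (subst nn_integral_lborel_complex(2)) simp_all
  also have "\<dots> = (\<integral>\<^sup>+y. \<integral>\<^sup>+x. u (Complex x y) \<partial>lborel \<partial>lborel)"
    by (intro nn_integral_cong nn_integral_lborel_translate [of "\<lambda>x. u (Complex x _)"]) measurable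
  also have "\<dots> = (\<integral>\<^sup>+z. u z \<partial>lborel)"
    by (rule nn_integral_lborel_complex(2) [symmetric]) measurable
  finally show ?thesis .
qed

lemma nn_integral_shear_y:
  fixes u :: "complex \<Rightarrow> ennreal"
  assumes [measurable]: "u \<in> borel_measurable borel"
  shows "(\<integral>\<^sup>+z. u (Complex (Re z) (b * Re z + Im z)) \<partial>lborel) = (\<integral>\<^sup>+z. u z \<partial>lborel)"
proof -
  have "(\<integral>\<^sup>+z. u (Complex (Re z) (b * Re z + Im z)) \<partial>lborel)
      = (\<integral>\<^sup>+x. \<integral>\<^sup>+y. u (Complex x (b * x + y)) \<partial>lborel \<partial>lborel)"
    by (subst nn_integral_lborel_complex(1)) simp_all
  also have "\<dots> = (\<integral>\<^sup>+x. \<integral>\<^sup>+y. u (Complex x y) \<partial>lborel \<partial>lborel)"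
    by (intro nn_integral_cong nn_integral_lborel_translate [of "\<lambda>y. u (Complex _ y)"]) measurable
  also have "\<dots> = (\<integral>\<^sup>+z. u z \<partial>lborel)"
    by (rule nn_integral_lborel_complex(1) [symmetric]) measurable
  finally show ?thesis .
qed

text \<open>A rotation other than the half turn is a product of three shears, and a shear preserves area by
  Tonelli and translation invariance on the line.\<close>

lemma nn_integral_rotation_not_half_turn:
  fixes u :: "complex \<Rightarrow> ennreal"
  assumes [measurable]: "u \<in> borel_measurable borel" and c: "cmod c = 1" "c \<noteq> -1"
  shows "(\<integral>\<^sup>+z. u (c * z) \<partial>lborel) = (\<integral>\<^sup>+z. u z \<partial>lborel)"
proof -
  define q where "q = Im c"
  \<comment> \<open>If \<open>c = cis t\<close>, then \<open>a\<close> is \<open>- tan (t / 2)\<close>.\<close>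
  define a where "a = - q / (Re c + 1)"
  have pq: "(Re c)\<^sup>2 + q\<^sup>2 = 1"
    using c(1) by (simp add: q_def cmod_def)
  have "Re c \<noteq> -1"
    using pq c(2) by (auto simp: q_def complex_eq_iff)
  then have p1: "Re c + 1 \<noteq> 0"
    by linarith
  have ab: "1 + a * q = Re c"
    using p1 pq by (simp add: a_def field_simps power2_eq_square)
  have aq: "a * (1 + Re c) = - q"
    using p1 by (simp add: a_def field_simps)
  define v where "v z = u (Complex (a * Im z + Re z) (Im z))" for z
  define w where "w z = v (Complex (Re z) (q * Re z + Im z))" for z
  have [measurable]: "v \<in> borel_measurable borel"
    unfolding v_def by measurable
  have [measurable]: "w \<in> borel_measurable borel"
    unfolding w_def by measurable
  have "u (c * z) = w (Complex (a * Im z + Re z) (Im z))" for z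
  proof -
    have *: "Im (c * z) = q * (a * Im z + Re z) + Im z"
      by (simp add: ab [symmetric] algebra_simps) (simp add: q_def ab)
    have "a * (q * (a * Im z + Re z) + Im z) + (a * Im z + Re z)
        = (1 + a * q) * Re z + a * (1 + (1 + a * q)) * Im z"
      by (simp add: algebra_simps)
    also have "\<dots> = Re (c * z)"
      unfolding ab aq by (simp add: q_def)
    finally show ?thesis
      unfolding w_def v_def using * by (simp add: complex_eq_iff) (metis complex.collapse times_complex.sel)
  qed
  then have "(\<integral>\<^sup>+z. u (c * z) \<partial>lborel) = (\<integral>\<^sup>+z. w (Complex (a * Im z + Re z) (Im z)) \<partial>lborel)"
    by simp
  also have "\<dots> = (\<integral>\<^sup>+z. w z \<partial>lborel)"
    by (rule nn_integral_shear_x) measurable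
  also have "\<dots> = (\<integral>\<^sup>+z. v z \<partial>lborel)"
    unfolding w_def by (rule nn_integral_shear_y) measurable
  also have "\<dots> = (\<integral>\<^sup>+z. u z \<partial>lborel)"
    unfolding v_def by (rule nn_integral_shear_x) measurable
  finally show ?thesis .
qed

text \<open>The half turn, excluded above, is the square of a quarter turn.\<close>

lemma nn_integral_rotation:
  fixes u :: "complex \<Rightarrow> ennreal"
  assumes [measurable]: "u \<in> borel_measurable borel" and c: "cmod c = 1"
  shows "(\<integral>\<^sup>+z. u (c * z) \<partial>lborel) = (\<integral>\<^sup>+z. u z \<partial>lborel)"
proof (cases "c = -1")
  case False
  then show ?thesis
    using nn_integral_rotation_not_half_turn c by simp
next
  case True
  have "(\<integral>\<^sup>+z. u (\<i> * (\<i> * z)) \<partial>lborel) = (\<integral>\<^sup>+z. u (\<i> * z) \<partial>lborel)"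
    by (rule nn_integral_rotation_not_half_turn [of "\<lambda>z. u (\<i> * z)"]) (auto simp: complex_eq_iff)
  also have "\<dots> = (\<integral>\<^sup>+z. u z \<partial>lborel)"
    by (rule nn_integral_rotation_not_half_turn) (auto simp: complex_eq_iff)
  finally show ?thesis
    using True by (simp flip: mult.assoc)
qed

section \<open>Mean value inequalities\<close>

lemma set_integrable_circle:
  assumes "continuous_on (cball 0 1) g"
  shows "set_integrable lborel {0..2*pi} (\<lambda>t. cmod (g (cis t)))"
  by (intro borel_integrable_atLeastAtMost' continuous_intros continuous_on_compose2 [OF assms]) auto

text \<open>The factor \<open>1 - cmod z\<close> is the least distance from \<open>z\<close> to the circle, which bounds the Cauchy kernel.\<close>

lemma cmod_le_circle_mean:
  assumes contg: "continuous_on (cball 0 1) g" and holg: "g holomorphic_on \<bbbD>"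
    and z: "cmod z < 1"
  shows "2 * pi * (1 - cmod z) * cmod (g z) \<le> (LINT t:{0..2*pi}|lborel. cmod (g (cis t)))"
proof -
  let ?I = "LINT t:{0..2*pi}|lborel. cmod (g (cis t))"
  have "((\<lambda>u. g u / (u - z)) has_contour_integral (2 * of_real pi * \<i> * g z)) (circlepath 0 1)"
    by (rule Cauchy_integral_circlepath) (use assms in auto)
  then have I: "((\<lambda>t. g (cis t) / (cis t - z) * \<i> * cis t) has_integral (2 * of_real pi * \<i> * g z)) {0..2*pi}"
    by (simp add: circlepath_def has_contour_integral_part_circlepath_iff)
  note int = set_borel_integral_eq_integral [OF set_integrable_circle [OF contg]]
  have le: "cmod (g (cis t) / (cis t - z) * \<i> * cis t) \<le> cmod (g (cis t)) * (1 / (1 - cmod z))" for t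
  proof -
    have "1 - cmod z \<le> cmod (cis t - z)"
      using norm_triangle_ineq2 [of "cis t" z] by simp
    then show ?thesis
      using z by (simp add: norm_mult norm_divide frac_le)
  qed
  have "cmod (2 * of_real pi * \<i> * g z) \<le> integral {0..2*pi} (\<lambda>t. cmod (g (cis t)) * (1 / (1 - cmod z)))"
    unfolding integral_unique [OF I, symmetric]
    by (intro Henstock_Kurzweil_Integration.integral_norm_bound_integral le
        has_integral_integrable [OF I] integrable_on_mult_left int(1))
  also have "\<dots> = ?I * (1 / (1 - cmod z))"
    unfolding int(2) by (rule integral_mult_left)
  finally show ?thesis
    using z by (simp add: norm_mult field_simps)
qed

lemma nn_integral_circle:
  assumes "continuous_on (cball 0 1) g"
  shows "(\<integral>\<^sup>+t. indicator {0..2*pi} t * ennreal (cmod (g (cis t))) \<partial>lborel)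
     = ennreal (LINT t:{0..2*pi}|lborel. cmod (g (cis t)))"
  using set_integrable_circle [OF assms] unfolding set_integrable_def set_lebesgue_integral_def
  by (subst nn_integral_eq_integral [symmetric])
     (auto intro!: nn_integral_cong simp: indicator_def)

lemma area_ball_complex:
  fixes z :: complex
  assumes "r \<ge> 0"
  shows "emeasure lborel (ball z r) = ennreal (pi * r\<^sup>2)"
  using assms by (simp add: emeasure_ball unit_ball_vol_2)

text \<open>Average the circle mean value inequality over all circles around \<open>z\<close>. By rotation invariance
  the area integral equals the average of its rotated copies, so Tonelli's theorem does this without
  polar coordinates.\<close>

lemma area_mean_value_inequality:
  assumes hol: "f holomorphic_on S" and sub: "cball z r \<subseteq> S" and r: "r > 0"
  shows "ennreal (pi * r\<^sup>2 * cmod (f z)) \<le> (\<integral>\<^sup>+w. indicator (ball z r) w * ennreal (cmod (f w)) \<partial>lborel)"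
proof -
  define u where "u w = indicator (ball z r) w * ennreal (cmod (f w))" for w
  have "continuous_on (ball z r) (\<lambda>w. cmod (f w))"
    by (intro continuous_intros holomorphic_on_imp_continuous_on holomorphic_on_subset [OF hol])
      (use sub in auto)
  then have "(\<lambda>w. indicator (ball z r) w *\<^sub>R cmod (f w)) \<in> borel_measurable borel"
    by (rule borel_measurable_continuous_on_indicator [rotated]) simp
  then have "(\<lambda>w. ennreal (indicator (ball z r) w *\<^sub>R cmod (f w))) \<in> borel_measurable borel"
    by measurable
  also have "(\<lambda>w. ennreal (indicator (ball z r) w *\<^sub>R cmod (f w))) = u"
    by (auto simp: u_def indicator_def)
  finally have [measurable]: "u \<in> borel_measurable borel" .
  have [measurable]: "(cis :: real \<Rightarrow> complex) \<in> borel_measurable borel"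
    by (intro borel_measurable_continuous_onI continuous_intros)
  have [simp]: "(indicator (ball 0 r) :: complex \<Rightarrow> ennreal) \<in> borel_measurable borel"
    by (intro borel_measurable_indicator) simp
  have le: "indicator (ball 0 r) v * ennreal (2 * pi * cmod (f z))
      \<le> (\<integral>\<^sup>+t. indicator {0..2*pi} t * u (z + cis t * v) \<partial>lborel)" for v
  proof (cases "v \<in> ball 0 r")
    case True
    have in_S: "z + \<zeta> * v \<in> S" if "cmod \<zeta> \<le> 1" for \<zeta>
    proof -
      have "cmod (\<zeta> * v) \<le> 1 * r"
        unfolding norm_mult using that True by (intro mult_mono) auto
      then have "z + \<zeta> * v \<in> cball z r"
        by (simp add: dist_norm)
      then show ?thesis
        using sub by blast
    qed
    have contg: "continuous_on (cball 0 1) (\<lambda>\<zeta>. f (z + \<zeta> * v))"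
      by (intro continuous_intros continuous_on_compose2 [OF holomorphic_on_imp_continuous_on [OF hol]])
        (use in_S in auto)
    have "(f \<circ> (\<lambda>\<zeta>. z + \<zeta> * v)) holomorphic_on \<bbbD>"
      by (intro holomorphic_on_compose_gen [OF _ hol] holomorphic_intros) (use in_S in auto)
    then have "2 * pi * cmod (f z) \<le> (LINT t:{0..2*pi}|lborel. cmod (f (z + cis t * v)))"
      using cmod_le_circle_mean [OF contg, of 0] by (simp add: o_def)
    then have "ennreal (2 * pi * cmod (f z))
        \<le> (\<integral>\<^sup>+t. indicator {0..2*pi} t * ennreal (cmod (f (z + cis t * v))) \<partial>lborel)"
      unfolding nn_integral_circle [OF contg] by (rule ennreal_leI)
    also have "\<dots> = (\<integral>\<^sup>+t. indicator {0..2*pi} t * u (z + cis t * v) \<partial>lborel)"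
      using True by (intro nn_integral_cong) (simp add: u_def dist_norm norm_mult)
    finally show ?thesis
      using True by simp
  qed simp
  have "ennreal (2 * pi) * ennreal (pi * r\<^sup>2 * cmod (f z))
      = (\<integral>\<^sup>+v. indicator (ball (0::complex) r) v * ennreal (2 * pi * cmod (f z)) \<partial>lborel)"
    using r by (subst nn_integral_multc) (simp_all add: area_ball_complex ennreal_mult' [symmetric] mult_ac)
  also have "\<dots> \<le> (\<integral>\<^sup>+v. \<integral>\<^sup>+t. indicator {0..2*pi} t * u (z + cis t * v) \<partial>lborel \<partial>lborel)"
    by (intro nn_integral_mono le)
  also have "\<dots> = (\<integral>\<^sup>+t. \<integral>\<^sup>+v. indicator {0..2*pi} t * u (z + cis t * v) \<partial>lborel \<partial>lborel)"
    by (rule lborel_pair.Fubini') measurable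
  also have "\<dots> = (\<integral>\<^sup>+t. indicator {0..2*pi} t * (\<integral>\<^sup>+w. u w \<partial>lborel) \<partial>lborel)"
  proof (intro nn_integral_cong)
    fix t :: real
    have "(\<integral>\<^sup>+v. u (z + cis t * v) \<partial>lborel) = (\<integral>\<^sup>+v. u (z + v) \<partial>lborel)"
      by (rule nn_integral_rotation [of "\<lambda>v. u (z + v)"]) auto
    also have "\<dots> = (\<integral>\<^sup>+w. u w \<partial>lborel)"
      by (rule nn_integral_lborel_translate) measurable
    finally show "(\<integral>\<^sup>+v. indicator {0..2*pi} t * u (z + cis t * v) \<partial>lborel)
        = indicator {0..2*pi} t * (\<integral>\<^sup>+w. u w \<partial>lborel)"
      by (simp add: nn_integral_cmult)
  qed
  also have "\<dots> = ennreal (2 * pi) * (\<integral>\<^sup>+w. u w \<partial>lborel)"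
    by (simp add: nn_integral_multc)
  finally have "ennreal (2 * pi) * ennreal (pi * r\<^sup>2 * cmod (f z))
      \<le> ennreal (2 * pi) * (\<integral>\<^sup>+w. u w \<partial>lborel)" .
  then show ?thesis
    unfolding u_def by (subst (asm) ennreal_mult_le_mult_iff) auto
qed

text \<open>This replaces Jensen's inequality: it bounds a mean of \<open>\<bar>f\<bar>\<close> by a mean of \<open>\<bar>f\<bar>\<^sup>p\<close> at the cost of a
  parameter \<open>e\<close>, which \<open>optimize_powr\<close> then removes by taking \<open>e\<close> of the size of the norm.\<close>

lemma le_powr_interpolate:
  fixes x :: real
  assumes "x \<ge> 0" "e > 0" "p \<ge> 1"
  shows "x \<le> e + e powr (1 - p) * x powr p"
proof (cases "x \<le> e")
  case True
  then show ?thesis by (simp add: add_increasing2)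
next
  case False
  have "e powr (1 - p) * x powr p \<ge> x powr (1 - p) * x powr p"
    using False assms by (intro mult_right_mono powr_mono2') auto
  also have "x powr (1 - p) * x powr p = x"
    using False assms by (simp flip: powr_add)
  finally show ?thesis
    using assms by linarith
qed

lemma optimize_powr:
  fixes x a b J p :: real
  assumes le: "\<And>e. e > 0 \<Longrightarrow> x \<le> a * e + b * (e powr (1 - p) * J)"
    and J: "J \<ge> 0" and p: "p \<ge> 1"
  shows "x \<le> (a + b) * J powr (1 / p)"
proof (cases "J = 0")
  case True
  have "((\<lambda>e. a * e) \<longlongrightarrow> a * 0) (at_right 0)"
    by (intro tendsto_intros)
  moreover have "\<forall>\<^sub>F e in at_right 0. x \<le> a * e"
    using le True by (auto simp: eventually_at_right_less eventually_at_filter)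
  ultimately have "x \<le> a * 0"
    by (intro tendsto_lowerbound) auto
  then show ?thesis using True by simp
next
  case False
  define e where "e = J powr (1 / p)"
  have "e > 0" using False J by (simp add: e_def)
  have "e powr (1 - p) * J = e powr (1 - p) * e powr p"
    using J p False by (simp add: e_def powr_powr)
  also have "\<dots> = e"
    using \<open>e > 0\<close> by (simp flip: powr_add)
  finally show ?thesis
    using le [OF \<open>e > 0\<close>] by (simp add: e_def algebra_simps)
qed

section \<open>Spaces of holomorphic functions with growth bounds\<close>

text \<open>This is what the eigenvalue problem uses of the Bergman and Hardy spaces. The growth bound controls both
  single functions near the boundary and, through the factor \<open>N f\<close>, point evaluations.\<close>

locale disk_function_space =
  fixes X :: "(complex \<Rightarrow> complex) set" and N :: "(complex \<Rightarrow> complex) \<Rightarrow> real"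
  assumes holomorphic: "f \<in> X \<Longrightarrow> f holomorphic_on \<bbbD>"
    and member_cong: "f \<in> X \<Longrightarrow> (\<And>z. z \<in> \<bbbD> \<Longrightarrow> g z = f z) \<Longrightarrow> g \<in> X"
    and norm_cong: "(\<And>z. z \<in> \<bbbD> \<Longrightarrow> g z = f z) \<Longrightarrow> N g = N f"
    and member_scale: "f \<in> X \<Longrightarrow> (\<lambda>z. c * f z) \<in> X"
    and norm_scale: "f \<in> X \<Longrightarrow> N (\<lambda>z. c * f z) \<le> cmod c * N f"
    and norm_nonneg: "0 \<le> N f"
    and member_bounded: "f holomorphic_on \<bbbD> \<Longrightarrow> (\<And>z. z \<in> \<bbbD> \<Longrightarrow> cmod (f z) \<le> B) \<Longrightarrow> f \<in> X"
    and growth: "\<exists>C\<ge>0. \<exists>K\<ge>0. \<forall>f\<in>X. \<forall>z\<in>\<bbbD>. cmod (f z) \<le> C * (1 - cmod z) powr - K * N f"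

section \<open>Hardy spaces\<close>

lemma in_disk_circle: "0 \<le> r \<Longrightarrow> r < 1 \<Longrightarrow> of_real r * cis t \<in> \<bbbD>"
  by (simp add: norm_mult)

lemma circle_integral_cong:
  assumes "\<And>z. z \<in> \<bbbD> \<Longrightarrow> g z = f z" "r \<in> {0..<1}"
  shows "circle_integral p g r = circle_integral p f r"
  using assms in_disk_circle unfolding circle_integral_def by (intro set_lebesgue_integral_cong) auto

lemma set_integrable_circle_powr:
  assumes "f holomorphic_on \<bbbD>" "r \<in> {0..<1}" "p > 0"
  shows "set_integrable lborel {0..2*pi} (\<lambda>t. cmod (f (of_real r * cis t)) powr p)"
proof -
  have "continuous_on {0..2*pi} (\<lambda>t. f (of_real r * cis t))"
    by (intro continuous_intros continuous_on_compose2 [OF holomorphic_on_imp_continuous_on [OF assms(1)]])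
      (use assms in_disk_circle in auto)
  then show ?thesis
    using assms(3) by (intro borel_integrable_atLeastAtMost' continuous_on_powr' continuous_intros) auto
qed

lemma circle_integral_scale:
  "circle_integral p (\<lambda>z. c * f z) r = cmod c powr p * circle_integral p f r"
  unfolding circle_integral_def by (simp add: norm_mult powr_mult)

lemma circle_integral_nonneg: "0 \<le> circle_integral p f r"
  unfolding circle_integral_def set_lebesgue_integral_def by (intro integral_nonneg_AE) auto

text \<open>Apply the circle estimate on the circle of radius \<open>(1 + cmod z) / 2\<close>, halfway between \<open>z\<close> and
  the boundary.\<close>

lemma hardy_growth:
  assumes p: "p \<ge> 1" and f: "f \<in> hardy_space p" and z: "z \<in> \<bbbD>"
  shows "cmod (f z) \<le> (2 + 1 / pi) / (1 - cmod z) * hardy_norm p f"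
proof -
  define S where "S = (SUP r\<in>{0..<1}. circle_integral p f r)"
  have hol: "f holomorphic_on \<bbbD>" and bdd: "bdd_above (circle_integral p f ` {0..<1})"
    using f by (auto simp: hardy_space_def)
  have le_S: "circle_integral p f r \<le> S" if "r \<in> {0..<1}" for r
    unfolding S_def using that bdd by (rule cSUP_upper)
  have S: "S \<ge> 0"
    using le_S [of 0] circle_integral_nonneg [of p f 0] by auto
  define r where "r = (1 + cmod z) / 2"
  have r: "0 < r" "r < 1" "cmod z < r"
    using z by (auto simp: r_def add_pos_nonneg)
  define g where "g \<zeta> = f (of_real r * \<zeta>)" for \<zeta>
  have in_disk: "of_real r * \<zeta> \<in> \<bbbD>" if "cmod \<zeta> \<le> 1" for \<zeta>
  proof -
    have "r * cmod \<zeta> \<le> r * 1"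
      using that r by (intro mult_left_mono) auto
    then have "r * cmod \<zeta> < 1"
      using r by linarith
    then show ?thesis
      using r by (simp add: norm_mult)
  qed
  have contg: "continuous_on (cball 0 1) g"
    unfolding g_def
    by (intro continuous_intros continuous_on_compose2 [OF holomorphic_on_imp_continuous_on [OF hol]])
      (use in_disk in auto)
  have "(f \<circ> (\<lambda>\<zeta>. of_real r * \<zeta>)) holomorphic_on \<bbbD>"
    by (intro holomorphic_on_compose_gen [OF _ hol] holomorphic_intros) (use in_disk in auto)
  then have holg: "g holomorphic_on \<bbbD>"
    by (simp add: g_def [abs_def] o_def)
  have "pi * (1 - cmod z) * cmod (f z) \<le> 2 * pi * e + 1 * (e powr (1 - p) * S)" if e: "e > 0" for e
  proof -
    have int0: "set_integrable lborel {0..2*pi} (\<lambda>t. e)"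
      by (simp add: set_integrable_def)
    have int1: "set_integrable lborel {0..2*pi} (\<lambda>t. e powr (1 - p) * cmod (f (of_real r * cis t)) powr p)"
      by (intro set_integrable_mult_right set_integrable_circle_powr [OF hol]) (use p r in auto)
    have int: "set_integrable lborel {0..2*pi} (\<lambda>t. e + e powr (1 - p) * cmod (g (cis t)) powr p)"
      unfolding g_def by (rule set_integral_add(1) [OF int0 int1])
    have "pi * (1 - cmod z) * cmod (f z) \<le> 2 * pi * (1 - cmod (z / of_real r)) * cmod (g (z / of_real r))"
    proof -
      have "(1 - cmod z) / 2 * r \<le> (1 - cmod z) / 2 * 1"
        using r by (intro mult_left_mono) auto
      moreover have "(1 - cmod z) / 2 = r - cmod z"
        by (simp add: r_def field_simps)
      moreover have "(1 - cmod z / r) * r = r - cmod z"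
        using r by (simp add: left_diff_distrib)
      ultimately have "(1 - cmod z) / 2 * r \<le> (1 - cmod z / r) * r"
        by linarith
      then have "(1 - cmod z) / 2 \<le> 1 - cmod z / r"
        using r by (simp only: mult_le_cancel_right_pos)
      then have "1 - cmod z \<le> 2 * (1 - cmod z / r)"
        by (simp only: field_sum_of_halves mult_2 le_divide_eq_numeral1 divide_le_eq_numeral1 mult.commute [of _ 2])
      then have "(1 - cmod z) * (pi * cmod (f z)) \<le> (2 * (1 - cmod z / r)) * (pi * cmod (f z))"
        by (rule mult_right_mono) simp
      then show ?thesis
        using r by (simp add: g_def norm_divide mult_ac)
    qed
    also have "\<dots> \<le> (LINT t:{0..2*pi}|lborel. cmod (g (cis t)))"
      using r by (intro cmod_le_circle_mean contg holg) (simp add: norm_divide)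
    also have "\<dots> \<le> (LINT t:{0..2*pi}|lborel. e + e powr (1 - p) * cmod (g (cis t)) powr p)"
      by (intro set_integral_mono set_integrable_circle contg int le_powr_interpolate) (use e p in auto)
    also have "\<dots> = (LINT t:{0..2*pi}|lborel. e) + e powr (1 - p) * circle_integral p f r"
      unfolding circle_integral_def g_def
      by (subst set_integral_add(2) [OF int0 int1]) simp
    also have "(LINT t:{0..2*pi}|lborel. e) = 2 * pi * e"
      by (simp add: set_lebesgue_integral_def)
    also have "2 * pi * e + e powr (1 - p) * circle_integral p f r \<le> 2 * pi * e + 1 * (e powr (1 - p) * S)"
      using le_S [of r] r by (simp add: mult_left_mono)
    finally show ?thesis .
  qed
  then have "pi * (1 - cmod z) * cmod (f z) \<le> (2 * pi + 1) * S powr (1 / p)"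
    by (intro optimize_powr S p) auto
  then show ?thesis
    using z by (simp add: hardy_norm_def S_def [symmetric] field_simps)
qed

lemma disk_function_space_hardy:
  assumes p: "p \<ge> 1"
  shows "disk_function_space (hardy_space p) (hardy_norm p)"
proof
  fix f assume f: "f \<in> hardy_space p"
  show "f holomorphic_on \<bbbD>"
    using f by (simp add: hardy_space_def)
next
  fix f g assume f: "f \<in> hardy_space p" and eq: "\<And>z. z \<in> \<bbbD> \<Longrightarrow> g z = f z"
  have "circle_integral p g ` {0..<1} = circle_integral p f ` {0..<1}"
    using circle_integral_cong [OF eq] by (intro image_cong) auto
  then show "g \<in> hardy_space p"
    using f eq holomorphic_cong [of \<bbbD> \<bbbD> g f] by (auto simp: hardy_space_def)
next
  fix f g :: "complex \<Rightarrow> complex" assume eq: "\<And>z. z \<in> \<bbbD> \<Longrightarrow> g z = f z"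
  have "circle_integral p g ` {0..<1} = circle_integral p f ` {0..<1}"
    using circle_integral_cong [OF eq] by (intro image_cong) auto
  then show "hardy_norm p g = hardy_norm p f"
    by (simp add: hardy_norm_def)
next
  fix f c assume f: "f \<in> hardy_space p"
  define S where "S = (SUP r\<in>{0..<1}. circle_integral p f r)"
  have hol: "f holomorphic_on \<bbbD>" and bdd: "bdd_above (circle_integral p f ` {0..<1})"
    using f by (auto simp: hardy_space_def)
  have le_S: "circle_integral p f r \<le> S" if "r \<in> {0..<1}" for r
    unfolding S_def using that bdd by (rule cSUP_upper)
  have S: "S \<ge> 0"
    using le_S [of 0] circle_integral_nonneg [of p f 0] by auto
  have le: "circle_integral p (\<lambda>z. c * f z) r \<le> cmod c powr p * S" if "r \<in> {0..<1}" for r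
    using le_S [OF that] by (simp add: circle_integral_scale mult_left_mono)
  have bdd': "bdd_above (circle_integral p (\<lambda>z. c * f z) ` {0..<1})"
    using le by (intro bdd_aboveI2)
  show "(\<lambda>z. c * f z) \<in> hardy_space p"
    using bdd' hol by (auto simp: hardy_space_def intro!: holomorphic_intros)
  have "0 \<le> (SUP r\<in>{0..<1}. circle_integral p (\<lambda>z. c * f z) r)"
    by (rule cSUP_upper2 [OF bdd', of 0]) (auto simp: circle_integral_nonneg)
  moreover have "(SUP r\<in>{0..<1}. circle_integral p (\<lambda>z. c * f z) r) \<le> cmod c powr p * S"
    by (rule cSUP_least) (use le in auto)
  ultimately have "hardy_norm p (\<lambda>z. c * f z) \<le> (cmod c powr p * S) powr (1 / p)"
    unfolding hardy_norm_def using p by (intro powr_mono2) auto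
  also have "\<dots> = cmod c * hardy_norm p f"
    using p S by (simp add: hardy_norm_def S_def [symmetric] powr_mult powr_powr)
  finally show "hardy_norm p (\<lambda>z. c * f z) \<le> cmod c * hardy_norm p f" .
next
  fix f show "0 \<le> hardy_norm p f"
    by (simp add: hardy_norm_def)
next
  fix f B assume hol: "f holomorphic_on \<bbbD>" and B: "\<And>z. z \<in> \<bbbD> \<Longrightarrow> cmod (f z) \<le> B"
  have "circle_integral p f r \<le> 2 * pi * B powr p" if r: "r \<in> {0..<1}" for r
  proof -
    have "circle_integral p f r \<le> (LINT t:{0..2*pi}|lborel. B powr p)"
      unfolding circle_integral_def
      by (intro set_integral_mono set_integrable_circle_powr [OF hol r] powr_mono2 B in_disk_circle)
        (use p r in \<open>auto simp: set_integrable_def\<close>)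
    then show ?thesis
      by (simp add: set_lebesgue_integral_def)
  qed
  then have "bdd_above (circle_integral p f ` {0..<1})"
    by (rule bdd_aboveI2)
  then show "f \<in> hardy_space p"
    using hol by (simp add: hardy_space_def)
next
  show "\<exists>C\<ge>0. \<exists>K\<ge>0. \<forall>f\<in>hardy_space p. \<forall>z\<in>\<bbbD>. cmod (f z) \<le> C * (1 - cmod z) powr - K * hardy_norm p f"
    using hardy_growth [OF p]
    by (intro exI [of _ "2 + 1 / pi"] exI [of _ 1] conjI ballI) (auto simp: powr_minus field_simps)
qed

section \<open>Bergman spaces\<close>

lemma nn_integral_bergman:
  assumes "f \<in> bergman_space p \<alpha>"
  shows "(\<integral>\<^sup>+w. indicator \<bbbD> w * ennreal (cmod (f w) powr p * (1 - (cmod w)\<^sup>2) powr \<alpha>) \<partial>lborel)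
     = ennreal (LINT w:\<bbbD>|lborel. cmod (f w) powr p * (1 - (cmod w)\<^sup>2) powr \<alpha>)"
  using assms unfolding bergman_space_def set_integrable_def set_lebesgue_integral_def
  by (subst nn_integral_eq_integral [symmetric]) (auto intro!: nn_integral_cong simp: indicator_def)

lemma continuous_on_bergman_weight:
  assumes f: "continuous_on \<bbbD> f" and p: "p > 0"
  shows "continuous_on \<bbbD> (\<lambda>w. cmod (f w) powr p * (1 - (cmod w)\<^sup>2) powr \<alpha>)"
proof (rule continuous_on_mult)
  show "continuous_on \<bbbD> (\<lambda>w. cmod (f w) powr p)"
    using p by (intro continuous_on_powr' continuous_intros f) auto
  have "(cmod w)\<^sup>2 < 1" if "w \<in> \<bbbD>" for w
    using that by (simp add: abs_square_less_1)
  then show "continuous_on \<bbbD> (\<lambda>w. (1 - (cmod w)\<^sup>2) powr \<alpha>)"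
    by (intro continuous_on_powr' continuous_intros) force+
qed

text \<open>Apply the area mean value inequality on the disc of radius half the distance \<open>d\<close> to the boundary;
  there the weight is at least \<open>(d / 2) powr \<bar>\<alpha>\<bar>\<close>, whatever the sign of \<open>\<alpha>\<close>.\<close>

lemma bergman_growth:
  assumes p: "p \<ge> 1" and f: "f \<in> bergman_space p \<alpha>" and z: "z \<in> \<bbbD>"
  shows "cmod (f z) \<le> (1 + 4 * 2 powr \<bar>\<alpha>\<bar> / pi) * pi powr (1 / p) * (1 - cmod z) powr - (2 + \<bar>\<alpha>\<bar>) * bergman_norm p \<alpha> f"
proof -
  define J where "J = (LINT w:\<bbbD>|lborel. cmod (f w) powr p * (1 - (cmod w)\<^sup>2) powr \<alpha>)"
  have J: "J \<ge> 0"
    unfolding J_def set_lebesgue_integral_def by (intro integral_nonneg_AE) auto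
  define d where "d = 1 - cmod z"
  have d: "0 < d" "d \<le> 1"
    using z by (auto simp: d_def)
  have hol: "f holomorphic_on \<bbbD>"
    using f by (simp add: bergman_space_def)
  then have cont: "continuous_on \<bbbD> f"
    by (rule holomorphic_on_imp_continuous_on)
  have near: "1 - cmod w \<ge> d / 2" if "w \<in> cball z (d / 2)" for w
    using that norm_triangle_ineq2 [of w z] by (simp add: d_def dist_norm norm_minus_commute)
  have sub: "cball z (d / 2) \<subseteq> \<bbbD>"
    using near d by fastforce
  have weight: "(d / 2) powr \<bar>\<alpha>\<bar> \<le> (1 - (cmod w)\<^sup>2) powr \<alpha>" if "w \<in> ball z (d / 2)" for w
  proof -
    have w: "d / 2 \<le> 1 - cmod w" "cmod w \<le> 1"
      using near [of w] that d by auto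
    have "(cmod w)\<^sup>2 \<le> cmod w"
      using w by (simp add: power2_eq_square mult_left_le)
    then have s: "d / 2 \<le> 1 - (cmod w)\<^sup>2"
      using w by linarith
    show ?thesis
    proof (cases "\<alpha> \<ge> 0")
      case True
      then show ?thesis
        using s d by (simp add: powr_mono2)
    next
      case False
      have "(d / 2) powr \<bar>\<alpha>\<bar> \<le> 1"
        using d by (intro powr_le1) auto
      also have "1 \<le> (1 - (cmod w)\<^sup>2) powr \<alpha>"
        using s d False powr_mono2' [of \<alpha> "1 - (cmod w)\<^sup>2" 1] by simp
      finally show ?thesis .
    qed
  qed
  define A where "A = 4 / (pi * d\<^sup>2) * (d / 2) powr - \<bar>\<alpha>\<bar>"
  have "cmod (f z) \<le> 1 * e + A * (e powr (1 - p) * J)" if e: "e > 0" for e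
  proof -
    define B where "B = e powr (1 - p) * (d / 2) powr - \<bar>\<alpha>\<bar>"
    have B: "B \<ge> 0" by (simp add: B_def)
    let ?F = "\<lambda>w. cmod (f w) powr p * (1 - (cmod w)\<^sup>2) powr \<alpha>"
    have le: "cmod (f w) \<le> e + B * ?F w" if w: "w \<in> ball z (d / 2)" for w
    proof -
      have "1 \<le> (d / 2) powr - \<bar>\<alpha>\<bar> * (1 - (cmod w)\<^sup>2) powr \<alpha>"
        using weight [OF w] d by (simp add: powr_minus field_simps)
      then have "e powr (1 - p) * cmod (f w) powr p * 1
          \<le> e powr (1 - p) * cmod (f w) powr p * ((d / 2) powr - \<bar>\<alpha>\<bar> * (1 - (cmod w)\<^sup>2) powr \<alpha>)"
        by (intro mult_left_mono) auto
      moreover have "cmod (f w) \<le> e + e powr (1 - p) * cmod (f w) powr p"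
        using e p by (intro le_powr_interpolate) auto
      moreover have "B * ?F w = e powr (1 - p) * cmod (f w) powr p * ((d / 2) powr - \<bar>\<alpha>\<bar> * (1 - (cmod w)\<^sup>2) powr \<alpha>)"
        by (simp add: B_def)
      ultimately show ?thesis
        by linarith
    qed
    have [measurable]: "(\<lambda>w. indicator \<bbbD> w * ennreal (?F w)) \<in> borel_measurable borel"
    proof -
      have "continuous_on \<bbbD> ?F"
        by (rule continuous_on_bergman_weight [OF cont]) (use p in simp)
      then have "(\<lambda>w. ennreal (indicator \<bbbD> w *\<^sub>R ?F w)) \<in> borel_measurable borel"
        by (intro measurable_compose [OF borel_measurable_continuous_on_indicator]) auto
      also have "(\<lambda>w. ennreal (indicator \<bbbD> w *\<^sub>R ?F w)) = (\<lambda>w. indicator \<bbbD> w * ennreal (?F w))"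
        by (auto simp: indicator_def)
      finally show ?thesis .
    qed
    have "ennreal (pi * (d / 2)\<^sup>2 * cmod (f z)) \<le> (\<integral>\<^sup>+w. indicator (ball z (d / 2)) w * ennreal (cmod (f w)) \<partial>lborel)"
      using d by (intro area_mean_value_inequality [OF hol sub]) auto
    also have "\<dots> \<le> (\<integral>\<^sup>+w. indicator (ball z (d / 2)) w * ennreal e + ennreal B * (indicator \<bbbD> w * ennreal (?F w)) \<partial>lborel)"
    proof (intro nn_integral_mono)
      fix w :: complex
      show "indicator (ball z (d / 2)) w * ennreal (cmod (f w))
        \<le> indicator (ball z (d / 2)) w * ennreal e + ennreal B * (indicator \<bbbD> w * ennreal (?F w))"
      proof (cases "w \<in> ball z (d / 2)")
        case True
        then have "w \<in> \<bbbD>"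
          using sub ball_subset_cball by blast
        then show ?thesis
          using le [OF True] True e B by (simp add: ennreal_mult' [symmetric] ennreal_plus [symmetric] ennreal_leI del: ennreal_plus)
      qed simp
    qed
    also have "\<dots> = ennreal (pi * (d / 2)\<^sup>2) * ennreal e + ennreal B * ennreal J"
    proof -
      have [measurable]: "(indicator (ball z (d / 2)) :: complex \<Rightarrow> ennreal) \<in> borel_measurable borel"
        by (intro borel_measurable_indicator) simp
      have "(\<integral>\<^sup>+w. indicator (ball z (d / 2)) w * ennreal e \<partial>lborel) = ennreal (pi * (d / 2)\<^sup>2) * ennreal e"
        using d by (subst nn_integral_multc) (simp_all add: area_ball_complex)
      moreover have "(\<integral>\<^sup>+w. ennreal B * (indicator \<bbbD> w * ennreal (?F w)) \<partial>lborel) = ennreal B * ennreal J"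
        by (subst nn_integral_cmult) (simp_all add: nn_integral_bergman [OF f] J_def)
      ultimately show ?thesis
        by (subst nn_integral_add) simp_all
    qed
    also have "\<dots> = ennreal (pi * (d / 2)\<^sup>2 * e + B * J)"
      using e B J by (simp add: ennreal_mult' [symmetric] ennreal_plus [symmetric] del: ennreal_plus)
    finally have "pi * (d / 2)\<^sup>2 * cmod (f z) \<le> pi * (d / 2)\<^sup>2 * e + B * J"
      using e B J by (subst (asm) ennreal_le_iff) auto
    then show ?thesis
      using d by (simp add: A_def B_def field_simps)
  qed
  then have "cmod (f z) \<le> (1 + A) * J powr (1 / p)"
    by (intro optimize_powr J p)
  also have "J powr (1 / p) = pi powr (1 / p) * bergman_norm p \<alpha> f"
    using J by (simp add: bergman_norm_def J_def [symmetric] powr_divide)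
  finally have *: "cmod (f z) \<le> (1 + A) * (pi powr (1 / p) * bergman_norm p \<alpha> f)" .
  have "1 + A \<le> (1 + 4 * 2 powr \<bar>\<alpha>\<bar> / pi) * d powr - (2 + \<bar>\<alpha>\<bar>)"
  proof -
    have "A = 4 * 2 powr \<bar>\<alpha>\<bar> / pi * d powr - (2 + \<bar>\<alpha>\<bar>)"
    proof -
      have "d powr - (2 + \<bar>\<alpha>\<bar>) = d powr - 2 * d powr - \<bar>\<alpha>\<bar>"
        by (simp flip: powr_add)
      also have "d powr - 2 = 1 / d\<^sup>2"
        using d by (simp add: powr_minus_divide)
      finally have "d powr - (2 + \<bar>\<alpha>\<bar>) = 1 / d\<^sup>2 * d powr - \<bar>\<alpha>\<bar>" .
      moreover have "(d / 2) powr - \<bar>\<alpha>\<bar> = 2 powr \<bar>\<alpha>\<bar> * d powr - \<bar>\<alpha>\<bar>"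
        using d by (simp add: powr_divide powr_minus field_simps)
      ultimately show ?thesis
        by (simp add: A_def)
    qed
    moreover have "1 \<le> d powr - (2 + \<bar>\<alpha>\<bar>)"
      using d powr_mono2' [of "- (2 + \<bar>\<alpha>\<bar>)" d 1] by simp
    ultimately show ?thesis
      by (simp add: algebra_simps)
  qed
  then have "(1 + A) * (pi powr (1 / p) * bergman_norm p \<alpha> f)
      \<le> (1 + 4 * 2 powr \<bar>\<alpha>\<bar> / pi) * d powr - (2 + \<bar>\<alpha>\<bar>) * (pi powr (1 / p) * bergman_norm p \<alpha> f)"
    by (intro mult_right_mono) (auto simp: bergman_norm_def)
  with * show ?thesis
    by (simp add: d_def mult_ac)
qed

text \<open>The annulus where \<open>1 - (cmod z)\<^sup>2 \<le> 2 powr - n\<close> has area \<open>\<pi> * 2 powr - n\<close>, so covering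
  the disk by these annuli bounds the integral by two geometric series; the one with ratio
  \<open>2 powr - (1 + \<alpha>)\<close> converges because \<open>\<alpha> > -1\<close>.\<close>

lemma bergman_weight_integrable:
  assumes "\<alpha> > -1"
  shows "set_integrable lborel \<bbbD> (\<lambda>z. (1 - (cmod z)\<^sup>2) powr \<alpha>)"
proof -
  let ?w = "\<lambda>z. (1 - (cmod z)\<^sup>2) powr \<alpha>"
  \<comment> \<open>The summand 1 covers \<open>\<alpha> \<ge> 0\<close>, the other one covers \<open>\<alpha> < 0\<close>.\<close>
  define c where "c n = 1 + (2 powr - real (Suc n)) powr \<alpha>" for n
  define A where "A n = \<bbbD> - ball (0::complex) (sqrt (1 - 2 powr - real n))" for n
  have c_nonneg: "c n \<ge> 0" for n by (simp add: c_def)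
  have [measurable]: "A n \<in> sets borel" for n
    by (simp add: A_def)
  have pow_le: "2 powr - real n \<le> (1::real)" for n
    using powr_mono [of "- real n" 0 2] by simp
  have emeasure_A: "emeasure lborel (A n) = ennreal (pi * 2 powr - real n)" for n
  proof -
    have "emeasure lborel (A n) = emeasure lborel \<bbbD> - emeasure lborel (ball (0::complex) (sqrt (1 - 2 powr - real n)))"
      unfolding A_def
    proof (intro emeasure_Diff)
      have "sqrt (1 - 2 powr - real n) \<le> 1"
        by simp
      then show "ball (0::complex) (sqrt (1 - 2 powr - real n)) \<subseteq> \<bbbD>"
        by (rule subset_ball)
    qed (use pow_le [of n] in \<open>auto simp: area_ball_complex\<close>)
    also have "\<dots> = ennreal (pi * 1\<^sup>2) - ennreal (pi * (sqrt (1 - 2 powr - real n))\<^sup>2)"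
      using pow_le [of n] by (simp add: area_ball_complex)
    also have "\<dots> = ennreal (pi * 2 powr - real n)"
      using pow_le [of n] by (simp add: ennreal_minus algebra_simps)
    finally show ?thesis .
  qed
  have le: "indicator \<bbbD> z * ennreal (?w z) \<le> (\<Sum>n. ennreal (c n) * indicator (A n) z)" for z
  proof (cases "z \<in> \<bbbD>")
    case True
    define s where "s = 1 - (cmod z)\<^sup>2"
    have s: "0 < s" "s \<le> 1"
      using True by (auto simp: s_def abs_square_less_1)
    define n where "n = nat \<lfloor>- log 2 s\<rfloor>"
    have log: "- log 2 s \<ge> 0"
      using s by simp
    have n: "real n \<le> - log 2 s" "- log 2 s < real (Suc n)"
    proof -
      have "real n = real_of_int \<lfloor>- log 2 s\<rfloor>"
        using log by (simp add: n_def)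
      then show "real n \<le> - log 2 s" "- log 2 s < real (Suc n)"
        using floor_correct [of "- log 2 s"] unfolding of_nat_Suc of_int_add of_int_1 by linarith+
    qed
    have s_le: "s \<le> 2 powr - real n"
      using n(1) s by (simp add: le_powr_iff)
    have s_ge: "2 powr - real (Suc n) \<le> s"
      using n(2) s by (intro less_imp_le) (simp add: powr_less_iff)
    have "z \<in> A n"
      using True s_le by (auto simp: A_def s_def not_less intro!: real_le_lsqrt)
    have "?w z \<le> c n"
    proof (cases "\<alpha> \<ge> 0")
      case True
      have "s powr \<alpha> \<le> 1"
        using s True by (intro powr_le1) auto
      then show ?thesis
        by (simp add: c_def s_def [symmetric] add_increasing2)
    next
      case False
      have "s powr \<alpha> \<le> (2 powr - real (Suc n)) powr \<alpha>"
        using s_ge False by (intro powr_mono2') auto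
      then show ?thesis
        by (simp add: c_def s_def [symmetric])
    qed
    then have "indicator \<bbbD> z * ennreal (?w z) \<le> (\<Sum>k\<in>{n}. ennreal (c k) * indicator (A k) z)"
      using True \<open>z \<in> A n\<close> by (simp add: ennreal_leI)
    also have "\<dots> \<le> (\<Sum>k. ennreal (c k) * indicator (A k) z)"
      by (intro sum_le_suminf) auto
    finally show ?thesis .
  qed simp
  have "(\<integral>\<^sup>+z. indicator \<bbbD> z * ennreal (?w z) \<partial>lborel)
      \<le> (\<integral>\<^sup>+z. (\<Sum>n. ennreal (c n) * indicator (A n) z) \<partial>lborel)"
    by (intro nn_integral_mono le)
  also have "\<dots> = (\<Sum>n. \<integral>\<^sup>+z. ennreal (c n) * indicator (A n) z \<partial>lborel)"
    by (intro nn_integral_suminf) measurable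
  also have "\<dots> = (\<Sum>n. ennreal (c n * (pi * 2 powr - real n)))"
    using c_nonneg by (simp add: nn_integral_cmult emeasure_A ennreal_mult')
  also have "\<dots> < \<infinity>"
  proof -
    have pow: "(2::real) powr - real n = (1 / 2) ^ n" for n
      by (simp add: powr_minus powr_realpow power_one_over field_simps)
    have "c n * (pi * 2 powr - real n)
        = pi * (1 / 2) ^ n + pi * 2 powr - \<alpha> * (2 powr - (1 + \<alpha>)) ^ n" for n
    proof -
      have "(2 powr - real (Suc n)) powr \<alpha> * 2 powr - real n = 2 powr - \<alpha> * (2 powr - (1 + \<alpha>)) powr real n"
        by (simp add: powr_powr powr_add [symmetric] algebra_simps)
      also have "(2 powr - (1 + \<alpha>)) powr real n = (2 powr - (1 + \<alpha>)) ^ n"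
        by (intro powr_realpow) auto
      finally show ?thesis
        by (simp add: c_def pow [symmetric] algebra_simps)
    qed
    moreover have "summable (\<lambda>n. pi * (1 / 2) ^ n + pi * 2 powr - \<alpha> * (2 powr - (1 + \<alpha>)) ^ n)"
    proof (intro summable_add summable_mult summable_geometric)
      show "norm (2 powr - (1 + \<alpha>)) < 1"
        using assms powr_less_mono [of "- (1 + \<alpha>)" 0 2] by simp
    qed simp
    ultimately have "summable (\<lambda>n. c n * (pi * 2 powr - real n))"
      by simp
    then show ?thesis
      using c_nonneg by (simp add: suminf_ennreal2 del: ennreal_suminf_neq_top)
  qed
  finally have fin: "(\<integral>\<^sup>+z. indicator \<bbbD> z * ennreal (?w z) \<partial>lborel) < \<infinity>" .
  have "continuous_on \<bbbD> ?w"
    using continuous_on_bergman_weight [of "\<lambda>_. 1" 1 \<alpha>] by simp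
  then have "(\<lambda>z. indicator \<bbbD> z *\<^sub>R ?w z) \<in> borel_measurable lborel"
    using borel_measurable_continuous_on_indicator [of \<bbbD> ?w] by simp
  then show ?thesis
    unfolding set_integrable_def
  proof (rule integrableI_bounded)
    have "(\<integral>\<^sup>+z. ennreal (norm (indicator \<bbbD> z *\<^sub>R ?w z)) \<partial>lborel) = (\<integral>\<^sup>+z. indicator \<bbbD> z * ennreal (?w z) \<partial>lborel)"
      by (intro nn_integral_cong) (auto simp: indicator_def)
    then show "(\<integral>\<^sup>+z. ennreal (norm (indicator \<bbbD> z *\<^sub>R ?w z)) \<partial>lborel) < \<infinity>"
      using fin by simp
  qed
qed

lemma disk_function_space_bergman:
  assumes p: "p \<ge> 1" and \<alpha>: "\<alpha> > -1"
  shows "disk_function_space (bergman_space p \<alpha>) (bergman_norm p \<alpha>)"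
proof
  fix f assume f: "f \<in> bergman_space p \<alpha>"
  show "f holomorphic_on \<bbbD>"
    using f by (simp add: bergman_space_def)
next
  fix f g assume f: "f \<in> bergman_space p \<alpha>" and eq: "\<And>z. z \<in> \<bbbD> \<Longrightarrow> g z = f z"
  have "set_integrable lborel \<bbbD> (\<lambda>z. cmod (g z) powr p * (1 - (cmod z)\<^sup>2) powr \<alpha>)
     \<longleftrightarrow> set_integrable lborel \<bbbD> (\<lambda>z. cmod (f z) powr p * (1 - (cmod z)\<^sup>2) powr \<alpha>)"
    using eq by (intro set_integrable_cong) auto
  then show "g \<in> bergman_space p \<alpha>"
    using f eq holomorphic_cong [of \<bbbD> \<bbbD> g f] by (auto simp: bergman_space_def)
next
  fix f g :: "complex \<Rightarrow> complex" assume eq: "\<And>z. z \<in> \<bbbD> \<Longrightarrow> g z = f z"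
  have "(LINT z:\<bbbD>|lborel. cmod (g z) powr p * (1 - (cmod z)\<^sup>2) powr \<alpha>)
     = (LINT z:\<bbbD>|lborel. cmod (f z) powr p * (1 - (cmod z)\<^sup>2) powr \<alpha>)"
    using eq by (intro set_lebesgue_integral_cong) auto
  then show "bergman_norm p \<alpha> g = bergman_norm p \<alpha> f"
    by (simp add: bergman_norm_def)
next
  fix f c assume f: "f \<in> bergman_space p \<alpha>"
  let ?J = "LINT z:\<bbbD>|lborel. cmod (f z) powr p * (1 - (cmod z)\<^sup>2) powr \<alpha>"
  have eq: "cmod (c * f z) powr p * (1 - (cmod z)\<^sup>2) powr \<alpha>
      = cmod c powr p * (cmod (f z) powr p * (1 - (cmod z)\<^sup>2) powr \<alpha>)" for z
    by (simp add: norm_mult powr_mult)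
  show "(\<lambda>z. c * f z) \<in> bergman_space p \<alpha>"
  proof -
    have "set_integrable lborel \<bbbD> (\<lambda>z. cmod (c * f z) powr p * (1 - (cmod z)\<^sup>2) powr \<alpha>)"
      unfolding eq using f by (intro set_integrable_mult_right) (simp add: bergman_space_def)
    then show ?thesis
      using f by (simp add: bergman_space_def holomorphic_intros)
  qed
  have "?J \<ge> 0"
    unfolding set_lebesgue_integral_def by (intro integral_nonneg_AE) auto
  then have "bergman_norm p \<alpha> (\<lambda>z. c * f z) = cmod c * bergman_norm p \<alpha> f"
    using p unfolding bergman_norm_def eq by (simp add: powr_divide powr_mult powr_powr)
  then show "bergman_norm p \<alpha> (\<lambda>z. c * f z) \<le> cmod c * bergman_norm p \<alpha> f"
    by simp
next
  fix f show "0 \<le> bergman_norm p \<alpha> f"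
    by (simp add: bergman_norm_def)
next
  fix f B assume hol: "f holomorphic_on \<bbbD>" and B: "\<And>z. z \<in> \<bbbD> \<Longrightarrow> cmod (f z) \<le> B"
  have "set_integrable lborel \<bbbD> (\<lambda>z. B powr p * (1 - (cmod z)\<^sup>2) powr \<alpha>)"
    using bergman_weight_integrable [OF \<alpha>] by simp
  then have "set_integrable lborel \<bbbD> (\<lambda>z. cmod (f z) powr p * (1 - (cmod z)\<^sup>2) powr \<alpha>)"
  proof (rule set_integrable_bound)
    have "continuous_on \<bbbD> (\<lambda>z. cmod (f z) powr p * (1 - (cmod z)\<^sup>2) powr \<alpha>)"
      by (rule continuous_on_bergman_weight [OF holomorphic_on_imp_continuous_on [OF hol]]) (use p in simp)
    then have "(\<lambda>z. indicator \<bbbD> z *\<^sub>R (cmod (f z) powr p * (1 - (cmod z)\<^sup>2) powr \<alpha>)) \<in> borel_measurable borel"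
      by (intro borel_measurable_continuous_on_indicator) auto
    then show "set_borel_measurable lborel \<bbbD> (\<lambda>z. cmod (f z) powr p * (1 - (cmod z)\<^sup>2) powr \<alpha>)"
      unfolding set_borel_measurable_def by simp
    show "AE z in lborel. z \<in> \<bbbD> \<longrightarrow> norm (cmod (f z) powr p * (1 - (cmod z)\<^sup>2) powr \<alpha>)
        \<le> norm (B powr p * (1 - (cmod z)\<^sup>2) powr \<alpha>)"
      using B p by (intro AE_I2 impI) (auto intro!: mult_right_mono powr_mono2)
  qed
  then show "f \<in> bergman_space p \<alpha>"
    using hol by (simp add: bergman_space_def)
next
  show "\<exists>C\<ge>0. \<exists>K\<ge>0. \<forall>f\<in>bergman_space p \<alpha>. \<forall>z\<in>\<bbbD>. cmod (f z) \<le> C * (1 - cmod z) powr - K * bergman_norm p \<alpha> f"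
    using bergman_growth [OF p]
    by (intro exI [of _ "(1 + 4 * 2 powr \<bar>\<alpha>\<bar> / pi) * pi powr (1 / p)"] exI [of _ "2 + \<bar>\<alpha>\<bar>"] conjI ballI)
       (auto intro!: add_nonneg_nonneg)
qed

section \<open>Eigenfunctions of the generator\<close>

text \<open>Norm convergence of the difference quotients implies pointwise convergence, because point
  evaluations are bounded.\<close>

lemma generator_maps_eigenfunction_limit:
  assumes "disk_function_space X N" and gen: "generator_maps X N (composition_op \<phi>) f (\<lambda>z. l * f z)" and z: "z \<in> \<bbbD>"
  shows "((\<lambda>t. (f (\<phi> t z) - f z) / of_real t) \<longlongrightarrow> l * f z) (at_right 0)"
proof -
  interpret disk_function_space X N by fact
  define G where "G t w = (f (\<phi> t w) - f w) / of_real t - l * f w" for t w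
  have G: "\<forall>\<^sub>F t in at_right 0. G t \<in> X" "((\<lambda>t. N (G t)) \<longlongrightarrow> 0) (at_right 0)"
    using gen by (simp_all add: generator_maps_def composition_op_def G_def [abs_def])
  obtain C K where CK: "\<And>g w. g \<in> X \<Longrightarrow> w \<in> \<bbbD> \<Longrightarrow> cmod (g w) \<le> C * (1 - cmod w) powr - K * N g"
    using growth by blast
  have "((\<lambda>t. C * (1 - cmod z) powr - K * N (G t)) \<longlongrightarrow> C * (1 - cmod z) powr - K * 0) (at_right 0)"
    by (intro tendsto_intros G)
  then have lim: "((\<lambda>t. C * (1 - cmod z) powr - K * N (G t)) \<longlongrightarrow> 0) (at_right 0)"
    by simp
  have "\<forall>\<^sub>F t in at_right 0. norm (G t z) \<le> C * (1 - cmod z) powr - K * N (G t)"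
    using G(1) by eventually_elim (rule CK [OF _ z])
  then have "((\<lambda>t. G t z) \<longlongrightarrow> 0) (at_right 0)"
    using lim by (rule Lim_null_comparison)
  then show ?thesis
    by (simp add: G_def LIM_zero_iff)
qed

text \<open>In the coordinate \<open>w = h z\<close> the semigroup is translation to the right, so the pointwise limit is
  the derivative along the real axis of \<open>F = f \<circ> h\<^sup>-\<^sup>1\<close>. As \<open>F\<close> is holomorphic, this gives \<open>F' = l F\<close>
  on the connected set \<open>h ` \<bbbD>\<close>.\<close>

lemma eigenfunction_eq_exp_koenigs:
  assumes k: "koenigs_function \<phi> h" and self: "\<And>t z. t \<ge> 0 \<Longrightarrow> z \<in> \<bbbD> \<Longrightarrow> \<phi> t z \<in> \<bbbD>"
    and hol: "f holomorphic_on \<bbbD>"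
    and lim: "\<And>z. z \<in> \<bbbD> \<Longrightarrow> ((\<lambda>t. (f (\<phi> t z) - f z) / of_real t) \<longlongrightarrow> l * f z) (at_right 0)"
  obtains c where "\<And>z. z \<in> \<bbbD> \<Longrightarrow> f z = c * exp (l * h z)"
proof -
  have holh: "h holomorphic_on \<bbbD>" and inj: "inj_on h \<bbbD>"
    and lin: "\<And>t z. t \<ge> 0 \<Longrightarrow> z \<in> \<bbbD> \<Longrightarrow> h (\<phi> t z) = h z + of_real t"
    using k by (auto simp: koenigs_function_def)
  obtain g where g: "g holomorphic_on h ` \<bbbD>" and gh: "\<And>z. z \<in> \<bbbD> \<Longrightarrow> g (h z) = z"
    using holomorphic_has_inverse [OF holh open_ball inj] by metis
  have op: "open (h ` \<bbbD>)"
    by (rule open_mapping_thm3 [OF holh open_ball inj])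
  have conn: "connected (h ` \<bbbD>)"
    by (intro connected_continuous_image holomorphic_on_imp_continuous_on holh) simp
  define F where "F w = f (g w)" for w
  have "(f \<circ> g) holomorphic_on h ` \<bbbD>"
    by (rule holomorphic_on_compose_gen [OF g hol]) (auto simp: gh)
  then have holF: "F holomorphic_on h ` \<bbbD>"
    by (simp add: F_def [abs_def] o_def)
  have dF: "(F has_field_derivative l * F w) (at w)" if w: "w \<in> h ` \<bbbD>" for w
  proof -
    obtain z where z: "z \<in> \<bbbD>" "w = h z"
      using w by blast
    obtain D where D: "(F has_field_derivative D) (at w)"
      using holF op w by (meson analytic_on_open field_differentiable_def holomorphic_on_imp_differentiable_at)
    have "filterlim (\<lambda>t. complex_of_real t) (at 0) (at_right 0)"
      unfolding filterlim_at
      by (auto intro!: tendsto_eq_intros simp: eventually_at_filter)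
    then have "((\<lambda>t. (F (w + of_real t) - F w) / of_real t) \<longlongrightarrow> D) (at_right 0)"
      using D unfolding DERIV_def by (rule filterlim_compose [rotated])
    moreover have "\<forall>\<^sub>F t in at_right 0. (F (w + of_real t) - F w) / of_real t = (f (\<phi> t z) - f z) / of_real t"
    proof (rule eventually_at_right_less [THEN eventually_mono])
      fix t :: real assume t: "0 < t"
      then have "F (w + of_real t) = f (\<phi> t z)"
        using lin [of t z] self [of t z] gh z by (metis F_def less_imp_le)
      then show "(F (w + of_real t) - F w) / of_real t = (f (\<phi> t z) - f z) / of_real t"
        using z by (simp add: F_def gh)
    qed
    ultimately have "((\<lambda>t. (f (\<phi> t z) - f z) / of_real t) \<longlongrightarrow> D) (at_right 0)"
      by (rule Lim_transform_eventually)
    then have "D = l * f z"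
      using lim [OF z(1)] by (intro tendsto_unique) auto
    then show ?thesis
      using D z by (simp add: F_def gh)
  qed
  have "((\<lambda>w. F w * exp (- l * w)) has_field_derivative 0) (at w)" if "w \<in> h ` \<bbbD>" for w
  proof -
    have "((\<lambda>w. exp (- l * w)) has_field_derivative - l * exp (- l * w)) (at w)"
      by (auto intro!: derivative_eq_intros)
    then show ?thesis
      using DERIV_mult [OF dF [OF that]] by fastforce
  qed
  moreover have "continuous_on (h ` \<bbbD>) (\<lambda>w. F w * exp (- l * w))"
    by (intro continuous_intros holomorphic_on_imp_continuous_on holF)
  ultimately obtain c where c: "\<And>w. w \<in> h ` \<bbbD> \<Longrightarrow> F w * exp (- l * w) = c"
    using DERIV_zero_connected_constant [OF conn op finite.emptyI, of "\<lambda>w. F w * exp (- l * w)"] by auto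
  have "f z = c * exp (l * h z)" if "z \<in> \<bbbD>" for z
  proof -
    have "F (h z) * exp (- l * h z) * exp (l * h z) = c * exp (l * h z)"
      using c that by simp
    then show ?thesis
      using that by (simp add: F_def gh mult.assoc flip: exp_add)
  qed
  then show ?thesis using that by blast
qed

text \<open>Conversely, along \<open>f = exp (l * h)\<close> the difference quotients are scalar multiples of \<open>f\<close>, so their norm
  convergence is the differentiability of \<open>exp\<close> at 0.\<close>

lemma point_spectrum_iff_exp_koenigs:
  assumes "disk_function_space X N" and k: "koenigs_function \<phi> h"
    and self: "\<And>t z. t \<ge> 0 \<Longrightarrow> z \<in> \<bbbD> \<Longrightarrow> \<phi> t z \<in> \<bbbD>"
  shows "l \<in> generator_point_spectrum X N (composition_op \<phi>) \<longleftrightarrow> (\<lambda>z. exp (l * h z)) \<in> X"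
proof
  interpret disk_function_space X N by fact
  assume "l \<in> generator_point_spectrum X N (composition_op \<phi>)"
  then obtain f z0 where z0: "z0 \<in> \<bbbD>" "f z0 \<noteq> 0" and gen: "generator_maps X N (composition_op \<phi>) f (\<lambda>z. l * f z)"
    by (auto simp: generator_point_spectrum_def)
  have f: "f \<in> X"
    using gen by (simp add: generator_maps_def)
  obtain c where c: "\<And>z. z \<in> \<bbbD> \<Longrightarrow> f z = c * exp (l * h z)"
    using eigenfunction_eq_exp_koenigs [OF k self holomorphic [OF f]
        generator_maps_eigenfunction_limit [OF assms(1) gen]] by blast
  have "c \<noteq> 0"
    using c z0 by auto
  show "(\<lambda>z. exp (l * h z)) \<in> X"
    by (rule member_cong [OF member_scale [OF f, of "1 / c"]]) (use c \<open>c \<noteq> 0\<close> in auto)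
next
  interpret disk_function_space X N by fact
  assume f: "(\<lambda>z. exp (l * h z)) \<in> X"
  define f where "f z = exp (l * h z)" for z
  have f: "f \<in> X"
    using f by (simp add: f_def [abs_def])
  define c where "c t = (exp (l * of_real t) - 1) / of_real t - l" for t :: real
  have eq: "(composition_op \<phi> t f z - f z) / of_real t - l * f z = c t * f z" if "t > 0" "z \<in> \<bbbD>" for t z
  proof -
    have "composition_op \<phi> t f z = exp (l * of_real t) * f z"
      using k that by (simp add: composition_op_def f_def koenigs_function_def algebra_simps exp_add)
    then show ?thesis
      using that by (simp add: c_def field_simps)
  qed
  let ?G = "\<lambda>t z. (composition_op \<phi> t f z - f z) / of_real t - l * f z"
  have "((\<lambda>w. exp (l * w)) has_field_derivative l) (at 0)"
    by (auto intro!: derivative_eq_intros)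
  then have "((\<lambda>w. (exp (l * w) - 1) / w) \<longlongrightarrow> l) (at 0)"
    by (simp add: DERIV_def)
  moreover have "filterlim (\<lambda>t. complex_of_real t) (at 0) (at_right 0)"
    unfolding filterlim_at
    by (auto intro!: tendsto_eq_intros simp: eventually_at_filter)
  ultimately have "((\<lambda>t. (exp (l * of_real t) - 1) / of_real t) \<longlongrightarrow> l) (at_right 0)"
    by (rule filterlim_compose)
  then have "(c \<longlongrightarrow> l - l) (at_right 0)"
    unfolding c_def [abs_def] by (intro tendsto_intros)
  then have c: "((\<lambda>t. cmod (c t) * N f) \<longlongrightarrow> 0) (at_right 0)"
    by (intro tendsto_mult_left_zero tendsto_norm_zero) simp
  have N: "N (?G t) \<le> cmod (c t) * N f" if "t > 0" for t
    using norm_scale [OF f, of "c t"] norm_cong [OF eq] that by simp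
  have "generator_maps X N (composition_op \<phi>) f (\<lambda>z. l * f z)"
    unfolding generator_maps_def
  proof (intro conjI)
    show "\<forall>\<^sub>F t in at_right 0. ?G t \<in> X"
      by (rule eventually_mono [OF eventually_at_right_less]) (rule member_cong [OF member_scale [OF f] eq])
    have "\<forall>\<^sub>F t in at_right 0. norm (N (?G t)) \<le> cmod (c t) * N f"
      by (rule eventually_mono [OF eventually_at_right_less]) (use N norm_nonneg in simp)
    then show "((\<lambda>t. N (?G t)) \<longlongrightarrow> 0) (at_right 0)"
      using c by (rule Lim_null_comparison)
  qed (use f member_scale in auto)
  moreover have "f 0 \<noteq> 0" "(0::complex) \<in> \<bbbD>"
    by (auto simp: f_def)
  ultimately show "l \<in> generator_point_spectrum X N (composition_op \<phi>)"
    unfolding generator_point_spectrum_def by blast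
qed

section \<open>Schwarz--Pick estimates\<close>

lemma one_minus_cnj_mult_nonzero:
  assumes "cmod a < 1" "cmod b < 1"
  shows "1 - cnj a * b \<noteq> 0"
proof
  assume "1 - cnj a * b = 0"
  then have "cmod a * cmod b = 1"
    by (metis complex_mod_cnj norm_mult norm_one right_minus_eq)
  moreover have "cmod a * cmod b \<le> cmod a * 1"
    using assms by (intro mult_left_mono) auto
  ultimately show False
    using assms by linarith
qed

lemma cmod_one_minus_cnj_mult_sq:
  "(cmod (1 - cnj a * b))\<^sup>2 - (cmod (b - a))\<^sup>2 = (1 - (cmod a)\<^sup>2) * (1 - (cmod b)\<^sup>2)"
  unfolding cmod_power2 by (simp add: power2_eq_square algebra_simps)

lemma Schwarz_Pick_at_0:
  assumes hol: "g holomorphic_on \<bbbD>" and img: "g ` \<bbbD> \<subseteq> \<bbbD>" and \<zeta>: "\<zeta> \<in> \<bbbD>"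
  shows "cmod (g \<zeta> - g 0) \<le> cmod \<zeta> * cmod (1 - cnj (g 0) * g \<zeta>)"
proof -
  have in_disk: "cmod (g z) < 1" if "cmod z < 1" for z
    using img that by (auto simp: image_subset_iff)
  let ?M = "Moebius_function 0 (g 0)"
  have "cmod ((?M \<circ> g) \<zeta>) \<le> cmod \<zeta>"
  proof (rule Schwarz_Lemma(1))
    show "?M \<circ> g holomorphic_on \<bbbD>"
      using in_disk img by (intro holomorphic_on_compose_gen [OF hol Moebius_function_holomorphic]) auto
    show "cmod ((?M \<circ> g) z) < 1" if "cmod z < 1" for z
      using in_disk that by (simp add: Moebius_function_norm_lt_1)
  qed (use \<zeta> in \<open>auto simp: Moebius_function_eq_zero\<close>)
  moreover have "1 - cnj (g 0) * g \<zeta> \<noteq> 0"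
    using in_disk \<zeta> by (intro one_minus_cnj_mult_nonzero) auto
  ultimately show ?thesis
    by (simp add: Moebius_function_simple norm_divide divide_le_eq)
qed

lemma Schwarz_Pick:
  assumes hol: "f holomorphic_on \<bbbD>" and img: "f ` \<bbbD> \<subseteq> \<bbbD>" and a: "a \<in> \<bbbD>" and b: "b \<in> \<bbbD>"
  shows "cmod (f b - f a) * cmod (1 - cnj a * b) \<le> cmod (b - a) * cmod (1 - cnj (f a) * f b)"
proof -
  let ?M = "Moebius_function 0 (- a)"
  define \<zeta> where "\<zeta> = Moebius_function 0 a b"
  have \<zeta>: "\<zeta> \<in> \<bbbD>" and M\<zeta>: "?M \<zeta> = b"
    using a b Moebius_function_norm_lt_1 [of a b 0] Moebius_function_compose [of "-a" a b]
    by (auto simp: \<zeta>_def)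
  have M0: "?M 0 = a"
    by (simp add: Moebius_function_of_zero)
  have M: "?M ` \<bbbD> \<subseteq> \<bbbD>"
    using a by (auto simp: Moebius_function_norm_lt_1)
  have "cmod ((f \<circ> ?M) \<zeta> - (f \<circ> ?M) 0) \<le> cmod \<zeta> * cmod (1 - cnj ((f \<circ> ?M) 0) * (f \<circ> ?M) \<zeta>)"
  proof (rule Schwarz_Pick_at_0)
    show "f \<circ> ?M holomorphic_on \<bbbD>"
      using a M by (intro holomorphic_on_compose_gen [OF Moebius_function_holomorphic hol]) auto
    show "(f \<circ> ?M) ` \<bbbD> \<subseteq> \<bbbD>"
      using M img by (auto simp: image_subset_iff)
  qed (rule \<zeta>)
  then have "cmod (f b - f a) \<le> cmod \<zeta> * cmod (1 - cnj (f a) * f b)"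
    by (simp add: M0 M\<zeta>)
  moreover have "1 - cnj a * b \<noteq> 0"
    using a b by (intro one_minus_cnj_mult_nonzero) auto
  ultimately show ?thesis
    by (simp add: \<zeta>_def Moebius_function_simple norm_divide field_simps)
qed

text \<open>The Schwarz--Pick inequality multiplied out, in the form that survives when \<open>a\<close> tends to the
  boundary.\<close>

lemma Schwarz_Pick_square:
  assumes hol: "f holomorphic_on \<bbbD>" and img: "f ` \<bbbD> \<subseteq> \<bbbD>" and a: "a \<in> \<bbbD>" and b: "b \<in> \<bbbD>"
  shows "(1 - (cmod a)\<^sup>2) * (1 - (cmod b)\<^sup>2) * (cmod (1 - cnj (f a) * f b))\<^sup>2
       \<le> (1 - (cmod (f a))\<^sup>2) * (1 - (cmod (f b))\<^sup>2) * (cmod (1 - cnj a * b))\<^sup>2"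
proof -
  have "(cmod (f b - f a) * cmod (1 - cnj a * b))\<^sup>2 \<le> (cmod (b - a) * cmod (1 - cnj (f a) * f b))\<^sup>2"
    using Schwarz_Pick [OF assms] by (intro power_mono) auto
  then show ?thesis
    unfolding cmod_one_minus_cnj_mult_sq [symmetric] by (simp add: power_mult_distrib algebra_simps)
qed

text \<open>A step of pseudohyperbolic length \<open>e\<close> shrinks the distance to the boundary at most by the factor
  \<open>1 - 3 * e\<close>. That this factor tends to 1 as \<open>e\<close> tends to 0 is what parabolic orbits require.\<close>

lemma pseudohyperbolic_step:
  assumes a: "cmod a < 1" and e: "0 \<le> e" "e < 1/3"
    and step: "cmod (b - a) \<le> e * cmod (1 - cnj a * b)"
  shows "(1 - 3 * e) * (1 - cmod a) \<le> 1 - cmod b"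
proof -
  have "1 - cnj a * b = of_real (1 - (cmod a)\<^sup>2) - cnj a * (b - a)"
    by (simp add: algebra_simps complex_norm_square [symmetric])
  then have "cmod (1 - cnj a * b) \<le> \<bar>1 - (cmod a)\<^sup>2\<bar> + cmod a * cmod (b - a)"
    by (metis complex_mod_cnj norm_mult norm_of_real norm_triangle_ineq4)
  also have "\<dots> \<le> 2 * (1 - cmod a) + cmod (b - a)"
  proof -
    have "(cmod a)\<^sup>2 \<le> 1"
      using a by (simp add: abs_square_le_1)
    moreover have "0 \<le> (1 - cmod a)\<^sup>2"
      by simp
    ultimately have "\<bar>1 - (cmod a)\<^sup>2\<bar> \<le> 2 * (1 - cmod a)"
      by (simp add: power2_diff)
    moreover have "cmod a * cmod (b - a) \<le> 1 * cmod (b - a)"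
      using a by (intro mult_right_mono) auto
    ultimately show ?thesis by simp
  qed
  finally have "e * cmod (1 - cnj a * b) \<le> e * (2 * (1 - cmod a) + cmod (b - a))"
    using e by (intro mult_left_mono) auto
  with step have *: "(1 - e) * cmod (b - a) \<le> (1 - e) * (3 * e * (1 - cmod a)) - e * (1 - 3 * e) * (1 - cmod a)"
    by (simp add: algebra_simps)
  also have "\<dots> \<le> (1 - e) * (3 * e * (1 - cmod a))"
    using e a by simp
  finally have "cmod (b - a) \<le> 3 * e * (1 - cmod a)"
    using e by simp
  moreover have "cmod b \<le> cmod a + cmod (b - a)"
    using norm_triangle_ineq [of a "b - a"] by simp
  ultimately show ?thesis
    by (simp add: algebra_simps)
qed

lemma pseudohyperbolic_chain:
  fixes x :: "nat \<Rightarrow> complex"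
  assumes x: "\<And>n. cmod (x n) < 1" and e: "0 \<le> e" "e < 1/3"
    and step: "\<And>n. cmod (x (Suc n) - x n) \<le> e * cmod (1 - cnj (x n) * x (Suc n))"
  shows "(1 - 3 * e) ^ n * (1 - cmod (x 0)) \<le> 1 - cmod (x n)"
proof (induction n)
  case (Suc n)
  have "(1 - 3 * e) ^ Suc n * (1 - cmod (x 0)) \<le> (1 - 3 * e) * (1 - cmod (x n))"
    using mult_left_mono [OF Suc, of "1 - 3 * e"] e by (simp add: mult.assoc)
  also have "\<dots> \<le> 1 - cmod (x (Suc n))"
    by (rule pseudohyperbolic_step [OF x e step])
  finally show ?case .
qed simp

text \<open>Elements of a disk function space grow at most geometrically along a sequence that approaches the
  boundary at most geometrically. The exponent \<open>K\<close> depends on the space only, so it stays fixed when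
  \<open>k\<close> tends to 1.\<close>

lemma (in disk_function_space) growth_along_chain:
  obtains K where "\<And>f k x. f \<in> X \<Longrightarrow> 0 < k \<Longrightarrow> (\<And>n. x n \<in> \<bbbD>) \<Longrightarrow>
      (\<And>n. k ^ n * (1 - cmod (x 0)) \<le> 1 - cmod (x n)) \<Longrightarrow>
      \<exists>B. \<forall>n. cmod (f (x n)) \<le> B * (k powr - K) ^ n"
proof -
  obtain C K where "C \<ge> 0" and K: "K \<ge> 0"
    and CK: "\<And>f z. f \<in> X \<Longrightarrow> z \<in> \<bbbD> \<Longrightarrow> cmod (f z) \<le> C * (1 - cmod z) powr - K * N f"
    using growth by blast
  have "\<exists>B. \<forall>n. cmod (f (x n)) \<le> B * (k powr - K) ^ n"
    if f: "f \<in> X" and k: "0 < k" and x: "\<And>n. x n \<in> \<bbbD>"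
      and chain: "\<And>n. k ^ n * (1 - cmod (x 0)) \<le> 1 - cmod (x n)" for f k x
  proof (intro exI allI)
    fix n
    have x0: "0 < 1 - cmod (x 0)"
      using x [of 0] by simp
    have "(1 - cmod (x n)) powr - K \<le> (k ^ n * (1 - cmod (x 0))) powr - K"
      using chain K k x0 by (intro powr_mono2') auto
    also have "\<dots> = (k powr - K) ^ n * (1 - cmod (x 0)) powr - K"
      using k x0 by (simp add: powr_mult powr_powr powr_realpow [symmetric] mult.commute)
    finally have le: "(1 - cmod (x n)) powr - K \<le> (k powr - K) ^ n * (1 - cmod (x 0)) powr - K" .
    have "cmod (f (x n)) \<le> C * N f * (1 - cmod (x n)) powr - K"
      using CK [OF f x] by (simp add: mult_ac)
    also have "\<dots> \<le> C * N f * ((k powr - K) ^ n * (1 - cmod (x 0)) powr - K)"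
      using le \<open>C \<ge> 0\<close> norm_nonneg by (intro mult_left_mono) auto
    finally show "cmod (f (x n)) \<le> (C * N f * (1 - cmod (x 0)) powr - K) * (k powr - K) ^ n"
      by (simp add: mult_ac)
  qed
  then show ?thesis using that by blast
qed

section \<open>Parabolicity and the real part of eigenvalues\<close>

lemma angular_derivative_radial_limits:
  assumes "has_angular_derivative f d \<tau>" and \<tau>: "cmod \<tau> = 1"
  obtains \<eta> where "cmod \<eta> = 1" "((\<lambda>r. f (of_real r * \<tau>)) \<longlongrightarrow> \<eta>) (at_left 1)"
    "((\<lambda>r. (f (of_real r * \<tau>) - \<eta>) / (of_real r * \<tau> - \<tau>)) \<longlongrightarrow> d) (at_left 1)"
proof -
  obtain \<eta> where \<eta>: "cmod \<eta> = 1" and lim: "has_angular_limit f \<eta> \<tau>"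
    "has_angular_limit (\<lambda>z. (f z - \<eta>) / (z - \<tau>)) d \<tau>"
    using assms(1) by (auto simp: has_angular_derivative_def)
  have radial: "filterlim (\<lambda>r. of_real r * \<tau>) (at \<tau> within stolz_region \<tau> 2) (at_left 1)"
    unfolding filterlim_at
  proof
    have "((\<lambda>r. complex_of_real r * \<tau>) \<longlongrightarrow> of_real 1 * \<tau>) (at_left 1)"
      by (intro tendsto_intros)
    then show "((\<lambda>r. complex_of_real r * \<tau>) \<longlongrightarrow> \<tau>) (at_left 1)"
      by simp
    have "\<forall>\<^sub>F r in at_left 1. r \<in> {0<..<(1::real)}"
      by (rule eventually_at_leftI [of 0]) auto
    then show "\<forall>\<^sub>F r in at_left 1. complex_of_real r * \<tau> \<in> stolz_region \<tau> 2 \<and> complex_of_real r * \<tau> \<noteq> \<tau>"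
    proof eventually_elim
      case (elim r)
      have "cmod (of_real r * \<tau> - \<tau>) = cmod (of_real (r - 1) * \<tau>)"
        by (simp add: algebra_simps)
      also have "\<dots> = 1 - r"
        using elim \<tau> by (simp only: norm_mult norm_of_real) simp
      finally have "cmod (of_real r * \<tau> - \<tau>) = 1 - r" .
      then show ?case
        using elim \<tau> by (auto simp: stolz_region_def norm_mult)
    qed
  qed
  have "(f \<longlongrightarrow> \<eta>) (at \<tau> within stolz_region \<tau> 2)"
       "((\<lambda>z. (f z - \<eta>) / (z - \<tau>)) \<longlongrightarrow> d) (at \<tau> within stolz_region \<tau> 2)"
    using lim by (simp_all add: has_angular_limit_def)
  then show ?thesis
    using that [OF \<eta>] filterlim_compose [OF _ radial] by blast
qed

lemma cmod_one_minus_cnj_mult_unimodular: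
  assumes "cmod \<eta> = 1"
  shows "cmod (1 - cnj \<eta> * w) = cmod (\<eta> - w)"
proof -
  have "\<eta> * cnj \<eta> = 1"
    using assms by (simp add: complex_norm_square [symmetric])
  then have "\<eta> * (1 - cnj \<eta> * w) = \<eta> - w"
    by (metis mult.assoc mult.right_neutral mult_1 right_diff_distrib)
  then show ?thesis
    using assms by (metis mult_1 norm_mult)
qed

text \<open>Julia's lemma for boundary dilatation 1: let one of the two points in the Schwarz--Pick inequality
  tend radially to \<open>\<tau>\<close>, after dividing by its distance \<open>1 - r\<close> to the boundary.\<close>

lemma Julia_inequality:
  assumes hol: "f holomorphic_on \<bbbD>" and img: "f ` \<bbbD> \<subseteq> \<bbbD>" and \<tau>: "cmod \<tau> = 1" and \<eta>: "cmod \<eta> = 1"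
    and lim: "((\<lambda>r. f (of_real r * \<tau>)) \<longlongrightarrow> \<eta>) (at_left 1)"
      "((\<lambda>r. (f (of_real r * \<tau>) - \<eta>) / (of_real r * \<tau> - \<tau>)) \<longlongrightarrow> 1) (at_left 1)"
    and z: "z \<in> \<bbbD>"
  shows "(1 - (cmod z)\<^sup>2) * (cmod (\<eta> - f z))\<^sup>2 \<le> (1 - (cmod (f z))\<^sup>2) * (cmod (\<tau> - z))\<^sup>2"
proof -
  define q where "q r = (f (of_real r * \<tau>) - \<eta>) / (of_real r * \<tau> - \<tau>)" for r :: real
  let ?L = "\<lambda>r. (1 + r) * (1 - (cmod z)\<^sup>2) * (cmod (1 - cnj (f (of_real r * \<tau>)) * f z))\<^sup>2"
  let ?R = "\<lambda>r. 2 * cmod (q r) * (1 - (cmod (f z))\<^sup>2) * (cmod (1 - cnj (of_real r * \<tau>) * z))\<^sup>2"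
  have fz: "cmod (f z) < 1"
    using img z by (auto simp: image_subset_iff)
  have "\<forall>\<^sub>F r in at_left 1. r \<in> {0<..<(1::real)}"
    by (rule eventually_at_leftI [of 0]) auto
  then have le: "\<forall>\<^sub>F r in at_left 1. ?L r \<le> ?R r"
  proof eventually_elim
    case (elim r)
    define a where "a = of_real r * \<tau>"
    have a: "cmod a = r" "a \<in> \<bbbD>"
      using elim \<tau> by (simp_all add: a_def norm_mult)
    then have fa: "cmod (f a) < 1"
      using img by (auto simp: image_subset_iff)
    have "a \<noteq> \<tau>"
      using a \<tau> elim by auto
    then have "f a - \<eta> = q r * (a - \<tau>)"
      by (simp add: q_def a_def)
    moreover have "cmod (a - \<tau>) = 1 - r"
    proof -
      have "a - \<tau> = of_real (r - 1) * \<tau>"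
        by (simp add: a_def algebra_simps)
      then show ?thesis
        using elim \<tau> by (simp only: norm_mult norm_of_real) simp
    qed
    ultimately have "cmod (f a - \<eta>) = cmod (q r) * (1 - r)"
      by (simp add: norm_mult)
    then have "1 - cmod (f a) \<le> cmod (q r) * (1 - r)"
      using norm_triangle_ineq2 [of \<eta> "f a"] \<eta> by (simp add: norm_minus_commute)
    moreover have "1 - (cmod (f a))\<^sup>2 \<le> 2 * (1 - cmod (f a))"
    proof -
      have "0 \<le> (1 - cmod (f a))\<^sup>2" by simp
      then show ?thesis by (simp add: power2_diff)
    qed
    ultimately have fa_le: "1 - (cmod (f a))\<^sup>2 \<le> 2 * cmod (q r) * (1 - r)"
      by simp
    have "(1 - r) * ?L r = (1 - (cmod a)\<^sup>2) * (1 - (cmod z)\<^sup>2) * (cmod (1 - cnj (f a) * f z))\<^sup>2"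
      unfolding a_def [symmetric] a(1) by (simp add: power2_eq_square algebra_simps)
    also have "\<dots> \<le> (1 - (cmod (f a))\<^sup>2) * (1 - (cmod (f z))\<^sup>2) * (cmod (1 - cnj a * z))\<^sup>2"
      by (rule Schwarz_Pick_square [OF hol img a(2) z])
    also have "\<dots> \<le> (2 * cmod (q r) * (1 - r)) * (1 - (cmod (f z))\<^sup>2) * (cmod (1 - cnj a * z))\<^sup>2"
      using fa_le fz by (intro mult_right_mono) (auto simp: abs_square_le_1)
    also have "\<dots> = (1 - r) * ?R r"
      by (simp add: a_def mult_ac)
    finally show ?case
      using elim by (simp only: mult_le_cancel_left_pos diff_gt_0_iff_gt greaterThanLessThan_iff)
  qed
  have "(?L \<longlongrightarrow> (1 + 1) * (1 - (cmod z)\<^sup>2) * (cmod (1 - cnj \<eta> * f z))\<^sup>2) (at_left 1)"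
    by (intro tendsto_intros lim(1))
  moreover have "(?R \<longlongrightarrow> 2 * cmod 1 * (1 - (cmod (f z))\<^sup>2) * (cmod (1 - cnj (of_real 1 * \<tau>) * z))\<^sup>2) (at_left 1)"
    using lim(2) unfolding q_def by (intro tendsto_intros)
  ultimately have "(1 + 1) * (1 - (cmod z)\<^sup>2) * (cmod (1 - cnj \<eta> * f z))\<^sup>2
      \<le> 2 * cmod 1 * (1 - (cmod (f z))\<^sup>2) * (cmod (1 - cnj (of_real 1 * \<tau>) * z))\<^sup>2"
    using le by (intro tendsto_le [where F = "at_left (1::real)"]) auto
  then show ?thesis
    by (simp only: of_real_1 mult_1 cmod_one_minus_cnj_mult_unimodular [OF \<eta>]
        cmod_one_minus_cnj_mult_unimodular [OF \<tau>]) (simp add: algebra_simps)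
qed

lemma holo_semigroup_iterate:
  assumes "holo_semigroup \<phi>" "z \<in> \<bbbD>"
  shows "\<phi> (real n) z \<in> \<bbbD>" and "\<phi> (real (Suc n)) z = \<phi> 1 (\<phi> (real n) z)"
  using assms by (auto simp: holo_semigroup_def image_subset_iff)

text \<open>If the boundary value \<open>\<eta>\<close> differed from \<open>\<tau>\<close>, then along the orbit of 0, which converges to \<open>\<tau>\<close>,
  Julia's inequality would force \<open>1 - (cmod (x n))\<^sup>2\<close> to be eventually nondecreasing, although it is positive
  and tends to 0.\<close>

lemma boundary_value_at_denjoy_wolff:
  assumes sg: "holo_semigroup \<phi>" and dw: "denjoy_wolff_point \<phi> \<tau>" and \<eta>: "cmod \<eta> = 1"
    and lim: "((\<lambda>r. \<phi> 1 (of_real r * \<tau>)) \<longlongrightarrow> \<eta>) (at_left 1)"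
      "((\<lambda>r. (\<phi> 1 (of_real r * \<tau>) - \<eta>) / (of_real r * \<tau> - \<tau>)) \<longlongrightarrow> 1) (at_left 1)"
  shows "\<eta> = \<tau>"
proof (rule ccontr)
  assume ne: "\<eta> \<noteq> \<tau>"
  have \<tau>: "cmod \<tau> = 1" and conv: "((\<lambda>t. \<phi> t 0) \<longlongrightarrow> \<tau>) at_top"
    using dw by (auto simp: denjoy_wolff_point_def)
  have hol: "\<phi> 1 holomorphic_on \<bbbD>" and img: "\<phi> 1 ` \<bbbD> \<subseteq> \<bbbD>"
    using sg by (auto simp: holo_semigroup_def)
  define x where "x n = \<phi> (real n) 0" for n
  have x: "x n \<in> \<bbbD>" "x (Suc n) = \<phi> 1 (x n)" for n
    using holo_semigroup_iterate [OF sg, of 0 n] by (auto simp: x_def)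
  have x_lim: "x \<longlonglongrightarrow> \<tau>"
    unfolding x_def by (rule filterlim_compose [OF conv filterlim_real_sequentially])
  then have xS_lim: "(\<lambda>n. x (Suc n)) \<longlonglongrightarrow> \<tau>"
    by (rule LIMSEQ_Suc)
  \<comment> \<open>The threshold \<open>D / 2\<close> separates the limit \<open>D\<close> of one squared distance from the limit 0 of the other.\<close>
  define D where "D = (cmod (\<eta> - \<tau>))\<^sup>2"
  have "D > 0"
    using ne by (simp add: D_def)
  have "(\<lambda>n. (cmod (\<eta> - x (Suc n)))\<^sup>2) \<longlonglongrightarrow> (cmod (\<eta> - \<tau>))\<^sup>2"
    by (intro tendsto_intros xS_lim)
  then have ev1: "\<forall>\<^sub>F n in sequentially. D / 2 < (cmod (\<eta> - x (Suc n)))\<^sup>2"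
    using \<open>D > 0\<close> by (intro order_tendstoD) (auto simp: D_def)
  have "(\<lambda>n. (cmod (\<tau> - x n))\<^sup>2) \<longlonglongrightarrow> (cmod (\<tau> - \<tau>))\<^sup>2"
    by (intro tendsto_intros x_lim)
  from order_tendstoD(2) [OF this, of "D / 2"]
  have ev2: "\<forall>\<^sub>F n in sequentially. (cmod (\<tau> - x n))\<^sup>2 < D / 2"
    using \<open>D > 0\<close> by simp
  define s where "s n = 1 - (cmod (x n))\<^sup>2" for n
  have s_pos: "s n > 0" for n
    using x(1) [of n] by (simp add: s_def abs_square_less_1)
  \<comment> \<open>Eventually \<open>x n\<close> is closer to \<open>\<tau>\<close> than \<open>x (Suc n)\<close> is to \<open>\<eta>\<close>, so Julia's inequality gains.\<close>
  from ev1 ev2 have "\<forall>\<^sub>F n in sequentially. s n \<le> s (Suc n)"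
  proof eventually_elim
    case (elim n)
    have "s n * (D / 2) \<le> s n * (cmod (\<eta> - x (Suc n)))\<^sup>2"
      using elim s_pos [of n] by (intro mult_left_mono) auto
    also have "\<dots> \<le> s (Suc n) * (cmod (\<tau> - x n))\<^sup>2"
      using Julia_inequality [OF hol img \<tau> \<eta> lim x(1) [of n]] by (simp add: s_def x(2))
    also have "\<dots> \<le> s (Suc n) * (D / 2)"
      using elim s_pos [of "Suc n"] by (intro mult_left_mono) auto
    finally show ?case
      using \<open>D > 0\<close> by simp
  qed
  then obtain n0 where n0: "\<And>n. n \<ge> n0 \<Longrightarrow> s n \<le> s (Suc n)"
    by (auto simp: eventually_sequentially)
  have "s n0 \<le> s n" if "n \<ge> n0" for n
    using that by (induction rule: dec_induct) (auto intro: order_trans n0)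
  moreover have "s \<longlonglongrightarrow> 1 - (cmod \<tau>)\<^sup>2"
    unfolding s_def [abs_def] by (intro tendsto_intros x_lim)
  ultimately have "s n0 \<le> 1 - (cmod \<tau>)\<^sup>2"
    by (intro LIMSEQ_le_const) auto
  then show False
    using s_pos [of n0] \<tau> by simp
qed

text \<open>The angular derivative 1 says that \<open>\<phi> 1\<close> moves the radial point \<open>r * \<tau>\<close> by \<open>o(1 - r)\<close>, which is
  a pseudohyperbolic distance tending to 0.\<close>

lemma parabolic_small_displacement:
  assumes "parabolic \<phi>" and e: "e > 0"
  obtains w where "w \<in> \<bbbD>" "cmod (\<phi> 1 w - w) \<le> e * cmod (1 - cnj w * \<phi> 1 w)"
proof -
  obtain \<tau> where sg: "holo_semigroup \<phi>" and dw: "denjoy_wolff_point \<phi> \<tau>" and ad: "has_angular_derivative (\<phi> 1) 1 \<tau>"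
    using assms(1) by (auto simp: parabolic_def non_elliptic_def)
  have \<tau>: "cmod \<tau> = 1"
    using dw by (auto simp: denjoy_wolff_point_def)
  obtain \<eta> where \<eta>: "cmod \<eta> = 1" and lim: "((\<lambda>r. \<phi> 1 (of_real r * \<tau>)) \<longlongrightarrow> \<eta>) (at_left 1)"
    "((\<lambda>r. (\<phi> 1 (of_real r * \<tau>) - \<eta>) / (of_real r * \<tau> - \<tau>)) \<longlongrightarrow> 1) (at_left 1)"
    by (rule angular_derivative_radial_limits [OF ad \<tau>])
  have "\<eta> = \<tau>"
    by (rule boundary_value_at_denjoy_wolff [OF sg dw \<eta> lim])
  define q where "q r = (\<phi> 1 (of_real r * \<tau>) - \<tau>) / (of_real r * \<tau> - \<tau>)" for r :: real
  have "(q \<longlongrightarrow> 1) (at_left 1)"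
    using lim(2) \<open>\<eta> = \<tau>\<close> by (simp add: q_def [abs_def])
  then have "\<forall>\<^sub>F r in at_left 1. dist (q r) 1 < e"
    using e by (rule tendstoD)
  moreover have "\<forall>\<^sub>F r in at_left 1. r \<in> {0<..<(1::real)}"
    by (rule eventually_at_leftI [of 0]) auto
  ultimately have "\<forall>\<^sub>F r in at_left 1. dist (q r) 1 < e \<and> r \<in> {0<..<(1::real)}"
    by eventually_elim auto
  then have "\<exists>r. dist (q r) 1 < e \<and> r \<in> {0<..<1}"
    by (rule eventually_happens' [rotated]) simp
  then obtain r where r: "dist (q r) 1 < e" "0 < r" "r < 1"
    by auto
  define w where "w = of_real r * \<tau>"
  have w: "cmod w = r" "w \<in> \<bbbD>"
    using r \<tau> by (simp_all add: w_def norm_mult)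
  have fw: "cmod (\<phi> 1 w) < 1"
    using sg w(2) by (auto simp: holo_semigroup_def image_subset_iff)
  have "w \<noteq> \<tau>"
    using w r \<tau> by auto
  then have "\<phi> 1 w - w = (q r - 1) * (w - \<tau>)"
    by (simp add: q_def w_def field_simps)
  moreover have "cmod (w - \<tau>) = 1 - r"
  proof -
    have "w - \<tau> = of_real (r - 1) * \<tau>"
      by (simp add: w_def algebra_simps)
    then show ?thesis
      using r \<tau> by (simp only: norm_mult norm_of_real) simp
  qed
  ultimately have "cmod (\<phi> 1 w - w) = dist (q r) 1 * (1 - r)"
    by (simp add: norm_mult dist_norm)
  also have "\<dots> \<le> e * cmod (1 - cnj w * \<phi> 1 w)"
  proof (intro mult_mono)
    have "cmod (cnj w * \<phi> 1 w) \<le> r * 1"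
      unfolding norm_mult using fw w by (intro mult_mono) auto
    then show "1 - r \<le> cmod (1 - cnj w * \<phi> 1 w)"
      using norm_triangle_ineq2 [of 1 "cnj w * \<phi> 1 w"] by simp
  qed (use r e in auto)
  finally show ?thesis
    using that w(2) by blast
qed

text \<open>Start an orbit at a point moved by pseudohyperbolic distance at most \<open>e\<close>. By the Schwarz--Pick lemma
  all later steps are as short, so the orbit approaches the boundary at rate at most \<open>1 - 3 * e\<close>
  and \<open>exp (l * h)\<close> grows along it at most by the factor \<open>(1 - 3 * e) powr - K\<close> per step. But the actual factor
  is \<open>exp (Re l)\<close>, and \<open>e\<close> is arbitrary.\<close>

lemma Re_eigenvalue_nonpos:
  assumes "disk_function_space X N" and par: "parabolic \<phi>" and k: "koenigs_function \<phi> h"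
    and mem: "(\<lambda>z. exp (l * h z)) \<in> X"
  shows "Re l \<le> 0"
proof -
  interpret disk_function_space X N by fact
  have sg: "holo_semigroup \<phi>"
    using par by (simp add: parabolic_def non_elliptic_def)
  then have hol: "\<phi> 1 holomorphic_on \<bbbD>" and img: "\<phi> 1 ` \<bbbD> \<subseteq> \<bbbD>"
    by (auto simp: holo_semigroup_def)
  obtain K where K: "\<And>f k x. f \<in> X \<Longrightarrow> 0 < k \<Longrightarrow> (\<And>n. x n \<in> \<bbbD>) \<Longrightarrow>
      (\<And>n. k ^ n * (1 - cmod (x 0)) \<le> 1 - cmod (x n)) \<Longrightarrow>
      \<exists>B. \<forall>n. cmod (f (x n)) \<le> B * (k powr - K) ^ n"
    using growth_along_chain by metis
  have bound: "exp (Re l) * (1 - 3 * e) powr K \<le> 1" if e: "0 < e" "e < 1/3" for e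
  proof (rule ccontr)
    assume "\<not> ?thesis"
    then have gt: "exp (Re l) * (1 - 3 * e) powr K > 1"
      by simp
    obtain w where w: "w \<in> \<bbbD>" and small: "cmod (\<phi> 1 w - w) \<le> e * cmod (1 - cnj w * \<phi> 1 w)"
      using parabolic_small_displacement [OF par e(1)] by metis
    define x where "x n = \<phi> (real n) w" for n
    have x0: "x 0 = w"
      using sg w by (simp add: x_def holo_semigroup_def)
    have x: "x n \<in> \<bbbD>" "x (Suc n) = \<phi> 1 (x n)" for n
      using holo_semigroup_iterate [OF sg w, of n] by (auto simp: x_def)
    have step: "cmod (x (Suc n) - x n) \<le> e * cmod (1 - cnj (x n) * x (Suc n))" for n
    proof (induction n)
      case 0
      then show ?case
        using small by (simp add: x(2) x0)
    next
      case (Suc n)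
      have nz: "cmod (1 - cnj (x n) * x (Suc n)) > 0"
        using one_minus_cnj_mult_nonzero x(1) by simp
      have "cmod (x (Suc (Suc n)) - x (Suc n)) * cmod (1 - cnj (x n) * x (Suc n))
          \<le> cmod (x (Suc n) - x n) * cmod (1 - cnj (x (Suc n)) * x (Suc (Suc n)))"
        using Schwarz_Pick [OF hol img x(1) [of n] x(1) [of "Suc n"]] by (simp add: x(2))
      also have "\<dots> \<le> (e * cmod (1 - cnj (x n) * x (Suc n))) * cmod (1 - cnj (x (Suc n)) * x (Suc (Suc n)))"
        by (intro mult_right_mono Suc) simp
      finally have "cmod (x (Suc (Suc n)) - x (Suc n)) * cmod (1 - cnj (x n) * x (Suc n))
         \<le> (e * cmod (1 - cnj (x (Suc n)) * x (Suc (Suc n)))) * cmod (1 - cnj (x n) * x (Suc n))"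
        by (simp add: mult_ac)
      then show ?case
        using nz by (simp only: mult_le_cancel_right_pos)
    qed
    have chain: "(1 - 3 * e) ^ n * (1 - cmod (x 0)) \<le> 1 - cmod (x n)" for n
      by (rule pseudohyperbolic_chain [where x = x, OF _ _ _ step]) (use x e in auto)
    obtain B where B: "\<And>n. cmod (exp (l * h (x n))) \<le> B * ((1 - 3 * e) powr - K) ^ n"
      using K [of "\<lambda>z. exp (l * h z)" "1 - 3 * e" x, OF mem _ x(1) chain] e by auto
    have val: "cmod (exp (l * h (x n))) = cmod (exp (l * h w)) * exp (Re l) ^ n" for n
    proof -
      have "h (x n) = h w + of_real (real n)"
        using k w by (simp add: koenigs_function_def x_def)
      then have "exp (l * h (x n)) = exp (l * h w) * exp (of_nat n * l)"
        by (simp add: algebra_simps exp_add)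
      then show ?thesis
        by (simp add: norm_mult exp_of_nat_mult norm_power)
    qed
    have "(exp (Re l) * (1 - 3 * e) powr K) ^ n \<le> B / cmod (exp (l * h w))" for n
    proof -
      have "(1 - 3 * e) powr K * (1 - 3 * e) powr - K = 1"
        using e by (simp flip: powr_add)
      then have one: "((1 - 3 * e) powr K) ^ n * ((1 - 3 * e) powr - K) ^ n = 1"
        by (metis power_mult_distrib power_one)
      have "cmod (exp (l * h w)) * exp (Re l) ^ n * ((1 - 3 * e) powr K) ^ n
          \<le> B * ((1 - 3 * e) powr - K) ^ n * ((1 - 3 * e) powr K) ^ n"
        using B [of n] unfolding val by (rule mult_right_mono) simp
      also have "\<dots> = B"
        using one by (simp add: mult_ac)
      finally show ?thesis
        by (simp add: power_mult_distrib field_simps)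
    qed
    moreover obtain n where "B / cmod (exp (l * h w)) < (exp (Re l) * (1 - 3 * e) powr K) ^ n"
      using real_arch_pow [OF gt] by blast
    ultimately show False
      by (meson not_less)
  qed
  have "((\<lambda>e. exp (Re l) * (1 - 3 * e) powr K) \<longlongrightarrow> exp (Re l) * (1 - 3 * 0) powr K) (at_right 0)"
    by (intro tendsto_intros) auto
  moreover have "\<forall>\<^sub>F e in at_right 0. exp (Re l) * (1 - 3 * e) powr K \<le> 1"
    by (rule eventually_at_rightI [of 0 "1/3"]) (use bound in auto)
  ultimately have "exp (Re l) * (1 - 3 * 0) powr K \<le> 1"
    by (intro tendsto_upperbound) auto
  then show ?thesis by simp
qed

section \<open>Sectors inside the Koenigs domain\<close>

lemma open_sector_0:
  assumes "b \<le> pi"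
  shows "open (sector 0 b)"
proof -
  have "w \<in> sector 0 b \<longleftrightarrow> 0 < Im w \<and> Arg w < b" for w
    using Arg_lt_pi [of w] assms by (cases "w = 0") (auto simp: sector_def)
  then have "sector 0 b = {w. Im w > 0} \<inter> Arg -` {..<b}"
    by auto
  moreover have "open ({w. Im w > 0} \<inter> Arg -` {..<b})"
  proof (rule continuous_open_preimage)
    show "continuous_on {w. Im w > 0} Arg"
      by (rule continuous_on_subset [OF continuous_on_Arg]) (auto simp: complex_nonpos_Reals_iff)
  qed (auto simp: open_halfspace_Im_gt)
  ultimately show ?thesis by simp
qed

text \<open>Otherwise the sector contains a ray along which \<open>exp (\<i> * \<mu> * w)\<close> grows exponentially. The points
  at distance \<open>(1 + \<kappa> / 4) ^ n\<close> from the vertex lie in discs of proportional radius inside the sector,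
  so their preimages under \<open>h\<close> are joined by steps of pseudohyperbolic length at most \<open>1/4\<close>. Along these preimages
  the function grows only geometrically in \<open>n\<close>, while the exponential grows doubly exponentially.\<close>

lemma Arg_eigenvalue_le:
  assumes "disk_function_space X N" and k: "koenigs_function \<phi> h"
    and mem: "(\<lambda>z. exp (\<i> * \<mu> * h z)) \<in> X"
    and \<theta>: "0 < \<theta>" "\<theta> \<le> pi" and sub: "(+) q ` sector 0 \<theta> \<subseteq> h ` \<bbbD>"
    and \<mu>: "\<mu> \<noteq> 0"
  shows "Arg \<mu> + \<theta> \<le> pi"
proof (rule ccontr)
  interpret disk_function_space X N by fact
  assume "\<not> ?thesis"
  then have "pi - Arg \<mu> < \<theta>" by simp
  then obtain \<beta> where \<beta>: "pi - Arg \<mu> < \<beta>" "\<beta> < \<theta>"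
    using dense by blast
  have \<beta>0: "0 < \<beta>"
    using \<beta> Arg_le_pi [of \<mu>] by linarith
  define c where "c = - (cmod \<mu> * sin (Arg \<mu> + \<beta>))"
  have "sin (Arg \<mu> + \<beta>) < 0"
    using \<beta> \<theta> Arg_le_pi [of \<mu>] by (intro sin_lt_zero) auto
  then have "c > 0"
    using \<mu> by (simp add: c_def mult_pos_neg)
  have "cis \<beta> \<in> sector 0 \<theta>"
    using \<beta> \<beta>0 \<theta> by (simp add: sector_def Arg_cis)
  then obtain \<kappa> where \<kappa>: "\<kappa> > 0" "ball (cis \<beta>) \<kappa> \<subseteq> sector 0 \<theta>"
    using open_sector_0 [OF \<theta>(2)] open_contains_ball by blast
  obtain g where g: "g holomorphic_on h ` \<bbbD>" and gh: "\<And>z. z \<in> \<bbbD> \<Longrightarrow> g (h z) = z"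
    using holomorphic_has_inverse [of h \<bbbD>] k by (metis koenigs_function_def open_ball)
  define R where "R n = (1 + \<kappa> / 4) ^ n" for n
  have R: "R n > 0" for n
    using \<kappa> by (simp add: R_def)
  define w where "w n = q + of_real (R n) * cis \<beta>" for n
  have disc: "ball (w n) (\<kappa> * R n) \<subseteq> h ` \<bbbD>" for n
  proof
    fix v assume v: "v \<in> ball (w n) (\<kappa> * R n)"
    define u where "u = (v - q) / of_real (R n)"
    have "cis \<beta> - u = (w n - v) / of_real (R n)"
      using R [of n] by (simp add: u_def w_def field_simps)
    then have "cmod (cis \<beta> - u) < \<kappa>"
      using v R [of n] by (simp add: norm_divide dist_norm divide_less_eq)
    then have "u \<in> sector 0 \<theta>"
      using \<kappa> by (auto simp: dist_norm)
    moreover have "v - q = of_real (R n) * u"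
      using R [of n] by (simp add: u_def)
    ultimately have "v - q \<in> sector 0 \<theta>"
      using R [of n] by (simp add: sector_def Arg_times_of_real)
    then have "q + (v - q) \<in> (+) q ` sector 0 \<theta>"
      by (rule imageI)
    then show "v \<in> h ` \<bbbD>"
      using sub by auto
  qed
  define x where "x n = g (w n)" for n
  have w_in: "w n \<in> h ` \<bbbD>" for n
    using disc [of n] R [of n] \<kappa> by (auto simp: subset_iff)
  have x: "x n \<in> \<bbbD>" "h (x n) = w n" for n
    using w_in [of n] gh by (auto simp: x_def)
  have step: "cmod (x (Suc n) - x n) \<le> 1/4 * cmod (1 - cnj (x n) * x (Suc n))" for n
  proof -
    define T where "T \<zeta> = w n + of_real (\<kappa> * R n) * \<zeta>" for \<zeta>
    have T: "T ` \<bbbD> \<subseteq> h ` \<bbbD>"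
    proof (rule order_trans [OF _ disc [of n]])
      show "T ` \<bbbD> \<subseteq> ball (w n) (\<kappa> * R n)"
        using R [of n] \<kappa> by (auto simp: T_def dist_norm norm_mult)
    qed
    \<comment> \<open>The next point lies a quarter of the radius away from the centre of the disc, and \<open>1/4 < 1/3\<close>
      as the chain estimate requires.\<close>
    define \<zeta> where "\<zeta> = cis \<beta> / 4"
    have T_val: "T 0 = w n" "T \<zeta> = w (Suc n)"
      by (simp_all add: T_def \<zeta>_def w_def R_def algebra_simps)
    have "cmod ((g \<circ> T) \<zeta> - (g \<circ> T) 0) \<le> cmod \<zeta> * cmod (1 - cnj ((g \<circ> T) 0) * (g \<circ> T) \<zeta>)"
    proof (rule Schwarz_Pick_at_0)
      show "g \<circ> T holomorphic_on \<bbbD>"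
      proof (rule holomorphic_on_compose_gen [OF _ g T])
        show "T holomorphic_on \<bbbD>"
          unfolding T_def [abs_def] by (intro holomorphic_intros)
      qed
      show "(g \<circ> T) ` \<bbbD> \<subseteq> \<bbbD>"
      proof (rule image_subsetI)
        fix z assume "z \<in> \<bbbD>"
        then have "T z \<in> h ` \<bbbD>" using T by blast
        then show "(g \<circ> T) z \<in> \<bbbD>" using gh by auto
      qed
      show "\<zeta> \<in> \<bbbD>"
        by (simp add: \<zeta>_def norm_divide)
    qed
    moreover have "cmod \<zeta> = 1/4"
      by (simp add: \<zeta>_def norm_divide)
    ultimately show ?thesis
      by (simp add: T_val x_def)
  qed
  have chain: "(1 / 4) ^ n * (1 - cmod (x 0)) \<le> 1 - cmod (x n)" for n
    using pseudohyperbolic_chain [of x "1/4", OF _ _ _ step] x(1) by simp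
  obtain K where K: "\<And>f k x. f \<in> X \<Longrightarrow> 0 < k \<Longrightarrow> (\<And>n. x n \<in> \<bbbD>) \<Longrightarrow>
      (\<And>n. k ^ n * (1 - cmod (x 0)) \<le> 1 - cmod (x n)) \<Longrightarrow>
      \<exists>B. \<forall>n. cmod (f (x n)) \<le> B * (k powr - K) ^ n"
    using growth_along_chain by metis
  define M :: real where "M = (1 / 4) powr - K"
  have "M > 0" by (simp add: M_def)
  obtain B where B: "\<And>n. cmod (exp (\<i> * \<mu> * h (x n))) \<le> B * M ^ n"
    using K [of "\<lambda>z. exp (\<i> * \<mu> * h z)" "1 / 4" x, OF mem _ x(1) chain] by (auto simp: M_def)
  define d where "d = Im (\<mu> * q)"
  have val: "cmod (exp (\<i> * \<mu> * h (x n))) = exp (c * R n - d)" for n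
  proof -
    have "\<mu> = of_real (cmod \<mu>) * cis (Arg \<mu>)"
      using rcis_cmod_Arg [of \<mu>] by (simp add: rcis_def)
    then have "\<mu> * w n = \<mu> * q + of_real (R n * cmod \<mu>) * cis (Arg \<mu> + \<beta>)"
      unfolding w_def cis_mult [symmetric] of_real_mult by (metis (no_types, lifting) distrib_left mult.assoc mult.left_commute)
    then have "Im (\<mu> * w n) = d - c * R n"
      by (simp add: d_def c_def)
    then show ?thesis
      by (simp add: x(2) mult.assoc)
  qed
  have "B > 0"
    using B [of 0] val [of 0] exp_gt_zero [of "c * R 0 - d"] by (simp, linarith)
  have le: "c \<le> (d + ln B) * (1 / R n) + ln M * (real n / R n)" for n
  proof -
    have "exp (c * R n - d) \<le> B * M ^ n"
      using B [of n] unfolding val .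
    then have "c * R n - d \<le> ln (B * M ^ n)"
      using \<open>B > 0\<close> \<open>M > 0\<close> by (subst ln_ge_iff) auto
    also have "\<dots> = ln B + real n * ln M"
      using \<open>B > 0\<close> \<open>M > 0\<close> by (simp add: ln_mult ln_realpow)
    finally have "c * R n \<le> (d + ln B) + ln M * real n"
      by (simp add: mult.commute)
    then have "c \<le> ((d + ln B) + ln M * real n) / R n"
      using R [of n] by (simp add: pos_le_divide_eq)
    then show ?thesis
      by (simp add: add_divide_distrib)
  qed
  have gt1: "1 < norm (1 + \<kappa> / 4)"
    using \<kappa> by simp
  have "(\<lambda>n. 1 / R n) \<longlonglongrightarrow> 0"
    unfolding R_def by (rule LIMSEQ_divide_realpow_zero) (use \<kappa> in simp)
  moreover have "(\<lambda>n. real n / R n) \<longlonglongrightarrow> 0"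
    unfolding R_def by (rule lim_n_over_pown [OF gt1])
  ultimately have "(\<lambda>n. (d + ln B) * (1 / R n) + ln M * (real n / R n)) \<longlonglongrightarrow> (d + ln B) * 0 + ln M * 0"
    by (intro tendsto_intros)
  then have "c \<le> (d + ln B) * 0 + ln M * 0"
    by (rule LIMSEQ_le_const) (intro exI allI impI le)
  then show False
    using \<open>c > 0\<close> by simp
qed

section \<open>Sectors containing the Koenigs domain\<close>

lemma Im_mult_sector_nonneg:
  assumes u: "u \<in> sector 0 b" and \<mu>: "0 \<le> Arg \<mu>" "Arg \<mu> + b \<le> pi"
  shows "0 \<le> Im (\<mu> * u)"
proof -
  have "\<mu> * u = rcis (cmod \<mu>) (Arg \<mu>) * rcis (cmod u) (Arg u)"
    by (simp only: rcis_cmod_Arg)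
  then have "Im (\<mu> * u) = cmod \<mu> * cmod u * sin (Arg \<mu> + Arg u)"
    by (simp only: rcis_mult Im_rcis)
  moreover have "0 \<le> sin (Arg \<mu> + Arg u)"
    using u \<mu> by (intro sin_ge_zero) (auto simp: sector_def)
  ultimately show ?thesis
    by simp
qed

text \<open>On the sector \<open>q + sector 0 b\<close> the argument of \<open>\<mu> * (w - q)\<close> stays in \<open>[0, \<pi>]\<close>, so \<open>exp (\<i> * \<mu> * w)\<close>
  is bounded.\<close>

lemma exp_koenigs_mem:
  assumes "disk_function_space X N" and hol: "h holomorphic_on \<bbbD>"
    and sub: "h ` \<bbbD> \<subseteq> (+) q ` sector 0 b" and \<mu>: "0 \<le> Arg \<mu>" "Arg \<mu> + b \<le> pi"
  shows "(\<lambda>z. exp (\<i> * \<mu> * h z)) \<in> X"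
proof -
  interpret disk_function_space X N by fact
  show ?thesis
  proof (rule member_bounded)
    show "(\<lambda>z. exp (\<i> * \<mu> * h z)) holomorphic_on \<bbbD>"
      by (intro holomorphic_intros hol)
    fix z assume "z \<in> \<bbbD>"
    then obtain u where u: "u \<in> sector 0 b" "h z = q + u"
      using sub by blast
    have "Im (\<mu> * h z) \<ge> Im (\<mu> * q)"
      using Im_mult_sector_nonneg [OF u(1) \<mu>] by (simp add: u(2) distrib_left)
    then show "cmod (exp (\<i> * \<mu> * h z)) \<le> exp (- Im (\<mu> * q))"
      by (simp add: mult.assoc)
  qed
qed

section \<open>Inner and outer arguments and the point spectrum\<close>

lemma mem_closure_sector:
  assumes B: "0 < B" "B \<le> pi" and \<mu>: "0 \<le> Im \<mu>" "\<mu> = 0 \<or> Arg \<mu> \<le> B"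
  shows "\<mu> \<in> closure (sector 0 B)"
proof -
  \<comment> \<open>Polar coordinates map the open strip into the sector, hence its closure into the closed sector.\<close>
  let ?F = "\<lambda>x. rcis (fst x) (snd x)"
  let ?S = "({0<..} :: real set) \<times> {0<..<B}"
  have S: "closure ?S = {0..} \<times> {0..B}"
    using B by (simp add: closure_Times)
  have "?F ` closure ?S \<subseteq> closure (sector 0 B)"
  proof (rule image_closure_subset)
    show "continuous_on (closure ?S) ?F"
      unfolding rcis_def by (intro continuous_intros)
    have "?F x \<in> sector 0 B" if "x \<in> ?S" for x
      using that B by (auto simp: sector_def Arg_rcis)
    then show "?F ` ?S \<subseteq> closure (sector 0 B)"
      using closure_subset by blast
  qed simp
  moreover have "\<mu> \<in> ?F ` ({0..} \<times> {0..B})"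
  proof (cases "\<mu> = 0")
    case True
    then show ?thesis
      using B by (intro image_eqI [of _ _ "(0, 0)"]) auto
  next
    case False
    then show ?thesis
      using \<mu> Arg_less_0 [of \<mu>]
      by (intro image_eqI [of _ _ "(cmod \<mu>, Arg \<mu>)"]) (auto simp: rcis_cmod_Arg)
  qed
  ultimately show ?thesis
    unfolding S by blast
qed

lemma inner_argument_bounds:
  shows "0 \<le> inner_argument \<Omega>" and "inner_argument \<Omega> \<le> pi"
proof -
  let ?A = "{0} \<union> {\<theta>. 0 < \<theta> \<and> \<theta> \<le> pi \<and> (\<exists>q. (+) q ` sector 0 \<theta> \<subseteq> \<Omega>)}"
  have le: "x \<le> pi" if "x \<in> ?A" for x
    using that by auto
  have "bdd_above ?A"
    by (rule bdd_aboveI [OF le])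
  then show "0 \<le> inner_argument \<Omega>"
    unfolding inner_argument_def by (intro cSup_upper) auto
  show "inner_argument \<Omega> \<le> pi"
    unfolding inner_argument_def
  proof (rule cSup_least)
    show "?A \<noteq> {}"
      by blast
  qed (rule le)
qed

lemma outer_argument_le_pi:
  assumes "\<Omega> \<subseteq> sector 0 pi"
  shows "outer_argument \<Omega> \<le> pi"
  unfolding outer_argument_def
proof (rule cInf_lower)
  have "\<Omega> \<subseteq> (+) 0 ` sector 0 pi"
    using assms by simp
  then show "pi \<in> {\<theta>. 0 < \<theta> \<and> \<theta> \<le> pi \<and> (\<exists>q. \<Omega> \<subseteq> (+) q ` sector 0 \<theta>)}"
    using pi_gt_zero by blast
  show "bdd_below {\<theta>. 0 < \<theta> \<and> \<theta> \<le> pi \<and> (\<exists>q. \<Omega> \<subseteq> (+) q ` sector 0 \<theta>)}"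
    by (rule bdd_belowI [of _ 0]) auto
qed

lemma outer_argument_lessE:
  assumes "\<Omega> \<subseteq> sector 0 pi" and "outer_argument \<Omega> < y"
  obtains b q where "b < y" "\<Omega> \<subseteq> (+) q ` sector 0 b"
proof -
  have "\<Omega> \<subseteq> (+) 0 ` sector 0 pi"
    using assms by simp
  then have "pi \<in> {\<theta>. 0 < \<theta> \<and> \<theta> \<le> pi \<and> (\<exists>q. \<Omega> \<subseteq> (+) q ` sector 0 \<theta>)}"
    using pi_gt_zero by blast
  then have "{\<theta>. 0 < \<theta> \<and> \<theta> \<le> pi \<and> (\<exists>q. \<Omega> \<subseteq> (+) q ` sector 0 \<theta>)} \<noteq> {}"
    by (metis empty_iff)
  from cInf_lessD [OF this assms(2) [unfolded outer_argument_def]]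
  obtain b where "b < y" "\<exists>q. \<Omega> \<subseteq> (+) q ` sector 0 b"
    by auto
  then show ?thesis
    using that by auto
qed

lemma point_spectrum_upper:
  assumes X: "disk_function_space X N" and par: "parabolic \<phi>" and k: "koenigs_function \<phi> h"
    and l: "l \<in> generator_point_spectrum X N (composition_op \<phi>)"
  obtains \<mu> where "l = \<i> * \<mu>" "0 \<le> Im \<mu>" "\<mu> = 0 \<or> Arg \<mu> \<le> pi - inner_argument (h ` \<bbbD>)"
proof
  define \<mu> where "\<mu> = - \<i> * l"
  show l_eq: "l = \<i> * \<mu>"
    by (simp add: \<mu>_def)
  have self: "\<phi> t z \<in> \<bbbD>" if "t \<ge> 0" "z \<in> \<bbbD>" for t z
    using par that by (auto simp: parabolic_def non_elliptic_def holo_semigroup_def image_subset_iff)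
  have mem: "(\<lambda>z. exp (\<i> * \<mu> * h z)) \<in> X"
    using l point_spectrum_iff_exp_koenigs [OF X k self] by (simp add: l_eq)
  have "Re (\<i> * \<mu>) \<le> 0"
    by (rule Re_eigenvalue_nonpos [OF X par k mem])
  then show Im: "0 \<le> Im \<mu>"
    by simp
  show "\<mu> = 0 \<or> Arg \<mu> \<le> pi - inner_argument (h ` \<bbbD>)"
  proof (cases "\<mu> = 0")
    case False
    have "inner_argument (h ` \<bbbD>) \<le> pi - Arg \<mu>"
      unfolding inner_argument_def
    proof (rule cSup_least)
      fix x assume "x \<in> {0} \<union> {\<theta>. 0 < \<theta> \<and> \<theta> \<le> pi \<and> (\<exists>q. (+) q ` sector 0 \<theta> \<subseteq> h ` \<bbbD>)}"
      then consider "x = 0" | q where "0 < x" "x \<le> pi" "(+) q ` sector 0 x \<subseteq> h ` \<bbbD>"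
        by blast
      then show "x \<le> pi - Arg \<mu>"
      proof cases
        case 1
        then show ?thesis
          using Arg_le_pi by simp
      next
        case (2 q)
        then show ?thesis
          using Arg_eigenvalue_le [OF X k mem 2 False] by simp
      qed
    qed simp
    then show ?thesis by simp
  qed simp
qed

lemma point_spectrum_lower:
  assumes X: "disk_function_space X N" and par: "parabolic \<phi>" and k: "koenigs_function \<phi> h"
    and sub: "h ` \<bbbD> \<subseteq> (+) q ` sector 0 b" and \<mu>: "0 \<le> Arg \<mu>" "Arg \<mu> + b \<le> pi"
  shows "\<i> * \<mu> \<in> generator_point_spectrum X N (composition_op \<phi>)"
proof -
  have self: "\<phi> t z \<in> \<bbbD>" if "t \<ge> 0" "z \<in> \<bbbD>" for t z
    using par that by (auto simp: parabolic_def non_elliptic_def holo_semigroup_def image_subset_iff)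
  have "h holomorphic_on \<bbbD>"
    using k by (simp add: koenigs_function_def)
  then show ?thesis
    using exp_koenigs_mem [OF X _ sub \<mu>] point_spectrum_iff_exp_koenigs [OF X k self] by blast
qed

theorem theorem1p5:
  fixes \<phi> :: "real \<Rightarrow> complex \<Rightarrow> complex" and h :: "complex \<Rightarrow> complex"
    and p \<alpha> \<theta> \<Theta> :: real and \<Omega> :: "complex set"
  assumes "parabolic \<phi>" and "positive_hyperbolic_step \<phi>"
    and "koenigs_function \<phi> h" and "\<Omega> = h ` \<bbbD>"
    and "\<Omega> \<subseteq> sector 0 pi"
    and "p \<ge> 1" and "\<alpha> > -1"
    and "\<theta> = inner_argument \<Omega>" and "\<Theta> = outer_argument \<Omega>"
  shows "\<forall>\<sigma>\<in>{bergman_point_spectrum p \<alpha> \<phi>, hardy_point_spectrum p \<phi>}.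
    (\<theta> = 0 \<and> \<Theta> = 0 \<longrightarrow>
       (*) \<i> ` sector_lclosed 0 pi \<union> {0} \<subseteq> \<sigma> \<and>
       \<sigma> \<subseteq> (*) \<i> ` closure (sector 0 pi)) \<and>
    (\<theta> = \<Theta> \<and> 0 < \<theta> \<and> \<theta> < pi \<longrightarrow>
       (*) \<i> ` sector_lclosed 0 (pi - \<theta>) \<union> {0} \<subseteq> \<sigma> \<and>
       \<sigma> \<subseteq> (*) \<i> ` closure (sector 0 (pi - \<theta>))) \<and>
    (\<theta> = pi \<and> \<Theta> = pi \<longrightarrow> \<sigma> = {\<i> * of_real t | t. t \<ge> 0}) \<and>
    (\<theta> < \<Theta> \<longrightarrow>
       (if \<Theta> = pi then {\<i> * of_real t | t. t \<ge> 0}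
        else (*) \<i> ` sector_lclosed 0 (pi - \<Theta>) \<union> {0}) \<subseteq> \<sigma> \<and>
       \<sigma> \<subseteq> (*) \<i> ` closure (sector 0 (pi - \<theta>)))"
proof
  fix \<sigma> assume "\<sigma> \<in> {bergman_point_spectrum p \<alpha> \<phi>, hardy_point_spectrum p \<phi>}"
  then obtain X N where X: "disk_function_space X N"
    and \<sigma>: "\<sigma> = generator_point_spectrum X N (composition_op \<phi>)"
    using disk_function_space_bergman [OF assms(6,7)] disk_function_space_hardy [OF assms(6)]
    unfolding bergman_point_spectrum_def hardy_point_spectrum_def by blast
  have \<theta>: "0 \<le> \<theta>" "\<theta> \<le> pi"
    using inner_argument_bounds [of \<Omega>] assms(8) by auto
  have \<Theta>: "\<Theta> \<le> pi"
    using outer_argument_le_pi assms(5,9) by simp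
  have half_plane: "h ` \<bbbD> \<subseteq> (+) 0 ` sector 0 pi"
    using assms(4,5) by simp
  have half_line: "{\<i> * of_real t | t. t \<ge> 0} \<subseteq> \<sigma>"
  proof clarify
    fix t :: real assume "0 \<le> t"
    then have "Arg (of_real t) = 0"
      by simp
    then show "\<i> * of_real t \<in> \<sigma>"
      unfolding \<sigma> by (intro point_spectrum_lower [OF X assms(1,3) half_plane]) auto
  qed
  have lower: "(*) \<i> ` sector_lclosed 0 (pi - \<Theta>) \<union> {0} \<subseteq> \<sigma>"
  proof -
    have "\<i> * \<mu> \<in> \<sigma>" if "\<mu> \<in> sector_lclosed 0 (pi - \<Theta>)" for \<mu>
    proof -
      have \<mu>: "0 \<le> Arg \<mu>" "\<Theta> < pi - Arg \<mu>"
        using that by (auto simp: sector_lclosed_def)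
      obtain b q where "b < pi - Arg \<mu>" "\<Omega> \<subseteq> (+) q ` sector 0 b"
        using outer_argument_lessE [OF assms(5) \<mu>(2) [unfolded assms(9)]] by blast
      then show ?thesis
        unfolding \<sigma> using \<mu>(1) assms(4) by (intro point_spectrum_lower [OF X assms(1,3)]) auto
    qed
    moreover have "0 \<in> \<sigma>"
      using half_line by force
    ultimately show ?thesis by blast
  qed
  have upper: "\<sigma> \<subseteq> (*) \<i> ` closure (sector 0 (pi - \<theta>))" if "\<theta> < pi"
  proof
    fix l assume "l \<in> \<sigma>"
    then obtain \<mu> where \<mu>: "l = \<i> * \<mu>" "0 \<le> Im \<mu>" "\<mu> = 0 \<or> Arg \<mu> \<le> pi - \<theta>"
      using point_spectrum_upper [OF X assms(1,3)] assms(4,8) \<sigma> by metis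
    then have "\<mu> \<in> closure (sector 0 (pi - \<theta>))"
      using that \<theta> by (intro mem_closure_sector) auto
    then show "l \<in> (*) \<i> ` closure (sector 0 (pi - \<theta>))"
      using \<mu>(1) by blast
  qed
  have upper_pi: "\<sigma> \<subseteq> {\<i> * of_real t | t. t \<ge> 0}" if "\<theta> = pi"
  proof
    fix l assume "l \<in> \<sigma>"
    then obtain \<mu> where \<mu>: "l = \<i> * \<mu>" "0 \<le> Im \<mu>" "\<mu> = 0 \<or> Arg \<mu> \<le> pi - \<theta>"
      using point_spectrum_upper [OF X assms(1,3)] assms(4,8) \<sigma> by metis
    then have "\<mu> = 0 \<or> Arg \<mu> = 0"
      using that Arg_less_0 [of \<mu>] by auto
    then have "\<mu> = of_real (cmod \<mu>)"
      using rcis_cmod_Arg [of \<mu>] by (auto simp: rcis_def)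
    then have "l = \<i> * of_real (cmod \<mu>)"
      using \<mu>(1) by metis
    then show "l \<in> {\<i> * of_real t | t. t \<ge> 0}"
      using norm_ge_zero [of \<mu>] by blast
  qed
  show "(\<theta> = 0 \<and> \<Theta> = 0 \<longrightarrow>
       (*) \<i> ` sector_lclosed 0 pi \<union> {0} \<subseteq> \<sigma> \<and>
       \<sigma> \<subseteq> (*) \<i> ` closure (sector 0 pi)) \<and>
    (\<theta> = \<Theta> \<and> 0 < \<theta> \<and> \<theta> < pi \<longrightarrow>
       (*) \<i> ` sector_lclosed 0 (pi - \<theta>) \<union> {0} \<subseteq> \<sigma> \<and>
       \<sigma> \<subseteq> (*) \<i> ` closure (sector 0 (pi - \<theta>))) \<and>
    (\<theta> = pi \<and> \<Theta> = pi \<longrightarrow> \<sigma> = {\<i> * of_real t | t. t \<ge> 0}) \<and>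
    (\<theta> < \<Theta> \<longrightarrow>
       (if \<Theta> = pi then {\<i> * of_real t | t. t \<ge> 0}
        else (*) \<i> ` sector_lclosed 0 (pi - \<Theta>) \<union> {0}) \<subseteq> \<sigma> \<and>
       \<sigma> \<subseteq> (*) \<i> ` closure (sector 0 (pi - \<theta>)))"
  proof (intro conjI impI)
    assume "\<theta> = 0 \<and> \<Theta> = 0"
    then show "(*) \<i> ` sector_lclosed 0 pi \<union> {0} \<subseteq> \<sigma>" "\<sigma> \<subseteq> (*) \<i> ` closure (sector 0 pi)"
      using lower upper by simp_all
  next
    assume "\<theta> = \<Theta> \<and> 0 < \<theta> \<and> \<theta> < pi"
    then show "(*) \<i> ` sector_lclosed 0 (pi - \<theta>) \<union> {0} \<subseteq> \<sigma>"
      "\<sigma> \<subseteq> (*) \<i> ` closure (sector 0 (pi - \<theta>))"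
      using lower upper by simp_all
  next
    assume "\<theta> = pi \<and> \<Theta> = pi"
    then show "\<sigma> = {\<i> * of_real t | t. t \<ge> 0}"
      using half_line upper_pi by blast
  next
    assume less: "\<theta> < \<Theta>"
    show "(if \<Theta> = pi then {\<i> * of_real t | t. t \<ge> 0}
        else (*) \<i> ` sector_lclosed 0 (pi - \<Theta>) \<union> {0}) \<subseteq> \<sigma>"
      using half_line lower by simp
    show "\<sigma> \<subseteq> (*) \<i> ` closure (sector 0 (pi - \<theta>))"
      using upper less \<Theta> by simp
  qed
qed

end
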